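(* There exists an absolute constant $C>0$ such that every connected rainbow graph $R$ with $k$ vertices and minimum degree at least $C\log k$ is a fractalizer and satisfies \[ \operatorname{ind}(R) = \frac{k!}{k^k-k}. \]
   Context: A rainbow graph is a graph whose edges receive pairwise distinct colors. A colored graph $R$ on vertex set $[k]$ is viewed as a colored complete graph by giving all non-edges a single new color (here denoted $\emptyset$); so with $T = E(R)\cup\{\emptyset\}$, $R$ is the $T$-colored complete graph with $\chi_R(ij)=\{i,j\}$ if $ij\in E(R)$ and $\chi_R(ij)=\emptyset$ otherwise. Connectedness and minimum degree refer to the underlying graph $R$ (non-edges are not edges). Two colored complete graphs are isomorphic if there is a bijection of their vertex sets preserving all edge colors. For a $T$-colored complete graph $F$ on $k$ vertices and a $T$-colored complete graph $G$ on $n>k$ vertices, $I(F,G)$ is the number of $k$-subsets $S\subseteq V(G)$ with $G[S]\cong F$ as colored graphs, and $\varrho(F,G)=I(F,G)/\binom nk$. $I(F,n)$ is the maximum of $I(F,G)$ over all $T$-colored complete graphs $G$ on $n$ vertices, $\operatorname{ind}(F,n)=I(F,n)/\binom nk$, and $\operatorname{ind}(F)=\lim_{n\to\infty}\operatorname{ind}(F,n)$ (the inducibility). Iterated balanced blow-up: label $V(F)=[k]$; define $\mathcal{G}_F(n)$ inductively: for $n<k$ it consists of a $T$-colored complete graph on $n$ vertices (coloring irrelevant); for $n\ge k$, $G\in\mathcal{G}_F(n)$ if $V(G)=V_1\cup\cdots\cup V_k$ with $||V_i|-|V_j||\le1$, $G[V_i]\in\mathcal{G}_F(|V_i|)$,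 and for $v\in V_i,w\in V_j$, $i\neq j$, the color of $vw$ equals the color of $ij$ in $F$. $F$ is a fractalizer if $\operatorname{ind}(F)=\lim_{n\to\infty}\max_{G\in\mathcal{G}_F(n)}\varrho(F,G)$. *)

theory Defs
  imports Complex_Main "HOL-Library.Ramsey" "HOL-Library.Disjoint_Sets"
begin

section \<open>Simple graphs\<close>

definition simple_graph :: "'v set \<Rightarrow> 'v set set \<Rightarrow> bool" where
  "simple_graph V E \<longleftrightarrow> finite V \<and> E \<subseteq> [V]\<^bsup>2\<^esup>"

definition graph_connected :: "'v set \<Rightarrow> 'v set set \<Rightarrow> bool" where
  "graph_connected V E \<longleftrightarrow> V \<noteq> {} \<and> (\<forall>u\<in>V. \<forall>v\<in>V. (u, v) \<in> {(x, y). {x, y} \<in> E}\<^sup>*)"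

definition vertex_degree :: "'v set set \<Rightarrow> 'v \<Rightarrow> nat" where
  "vertex_degree E v = card {e \<in> E. v \<in> e}"

definition min_degree :: "'v set \<Rightarrow> 'v set set \<Rightarrow> nat" where
  "min_degree V E = Min (vertex_degree E ` V)"

section \<open>Colored complete graphs\<close>

text \<open>Only the values of \<open>color\<close> on two-element subsets of \<open>verts\<close> are meaningful.\<close>

record ('v, 'c) cgraph =
  verts :: "'v set"
  color :: "'v set \<Rightarrow> 'c"

definition colored_complete :: "'c set \<Rightarrow> ('v, 'c) cgraph \<Rightarrow> bool" where
  "colored_complete T G \<longleftrightarrow> finite (verts G) \<and> (\<forall>e\<in>[verts G]\<^bsup>2\<^esup>. color G e \<in> T)"

definition induced :: "('v, 'c) cgraph \<Rightarrow> 'v set \<Rightarrow> ('v, 'c) cgraph" where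
  "induced G S = \<lparr>verts = S, color = color G\<rparr>"

definition cg_iso :: "('v, 'c) cgraph \<Rightarrow> ('w, 'c) cgraph \<Rightarrow> bool" where
  "cg_iso G H \<longleftrightarrow>
     (\<exists>f. bij_betw f (verts G) (verts H) \<and> (\<forall>e\<in>[verts G]\<^bsup>2\<^esup>. color H (f ` e) = color G e))"

text \<open>The rainbow graph with vertex set \<open>{1..k}\<close> and edge set \<open>E\<close>: every edge is its own color,
  and the empty set is the additional color of the non-edges.\<close>

definition rainbow :: "nat \<Rightarrow> nat set set \<Rightarrow> (nat, nat set) cgraph" where
  "rainbow k E = \<lparr>verts = {1..k}, color = (\<lambda>e. if e \<in> E then e else {})\<rparr>"

definition rainbow_colors :: "nat set set \<Rightarrow> nat set set" where
  "rainbow_colors E = E \<union> {{}}"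

section \<open>Inducibility\<close>

definition copies :: "('v, 'c) cgraph \<Rightarrow> ('w, 'c) cgraph \<Rightarrow> nat" where
  "copies F G = card {S \<in> [verts G]\<^bsup>card (verts F)\<^esup>. cg_iso (induced G S) F}"

definition copy_density :: "('v, 'c) cgraph \<Rightarrow> ('w, 'c) cgraph \<Rightarrow> real" where
  "copy_density F G = real (copies F G) / real (card (verts G) choose card (verts F))"

text \<open>Every \<open>n\<close>-vertex graph has an isomorphic copy with vertices in \<open>nat\<close>, so the maxima below
  lose nothing by ranging over such graphs. They are taken over sets of numbers that are finite,
  although infinitely many graphs contribute.\<close>

definition max_copies :: "'c set \<Rightarrow> ('v, 'c) cgraph \<Rightarrow> nat \<Rightarrow> nat" where
  "max_copies T F n =
     Max {copies F G |G :: (nat, 'c) cgraph. colored_complete T G \<and> card (verts G) = n}"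

definition ind :: "'c set \<Rightarrow> ('v, 'c) cgraph \<Rightarrow> nat \<Rightarrow> real" where
  "ind T F n = real (max_copies T F n) / real (n choose card (verts F))"

text \<open>The limit exists, see \<open>convergent_ind\<close> below.\<close>

definition inducibility :: "'c set \<Rightarrow> ('v, 'c) cgraph \<Rightarrow> real" where
  "inducibility T F = lim (ind T F)"

section \<open>Iterated balanced blow-ups\<close>

text \<open>The parts are indexed by the vertices of \<open>F\<close>; graphs with fewer vertices than \<open>F\<close>
  carry an arbitrary coloring.\<close>

inductive iterated_blowup :: "'c set \<Rightarrow> ('v, 'c) cgraph \<Rightarrow> ('w, 'c) cgraph \<Rightarrow> bool"
  for T :: "'c set" and F :: "('v, 'c) cgraph" where
  small: "colored_complete T G \<Longrightarrow> card (verts G) < card (verts F) \<Longrightarrow> iterated_blowup T F G"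
| blowup:
    "finite (verts G) \<Longrightarrow> card (verts F) \<le> card (verts G) \<Longrightarrow>
     verts G = (\<Union>i\<in>verts F. P i) \<Longrightarrow> disjoint_family_on P (verts F) \<Longrightarrow>
     \<forall>i\<in>verts F. \<forall>j\<in>verts F. \<bar>int (card (P i)) - int (card (P j))\<bar> \<le> 1 \<Longrightarrow>
     \<forall>i\<in>verts F. iterated_blowup T F (induced G (P i)) \<Longrightarrow>
     \<forall>i\<in>verts F. \<forall>j\<in>verts F. i \<noteq> j \<longrightarrow>
       (\<forall>v\<in>P i. \<forall>w\<in>P j. color G {v, w} = color F {i, j}) \<Longrightarrow>
     iterated_blowup T F G"

definition max_blowup_density :: "'c set \<Rightarrow> ('v, 'c) cgraph \<Rightarrow> nat \<Rightarrow> real" where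
  "max_blowup_density T F n =
     Max {copy_density F G |G :: (nat, 'c) cgraph. iterated_blowup T F G \<and> card (verts G) = n}"

definition fractalizer :: "'c set \<Rightarrow> ('v, 'c) cgraph \<Rightarrow> bool" where
  "fractalizer T F \<longleftrightarrow> max_blowup_density T F \<longlonglongrightarrow> inducibility T F"

section \<open>Existence of the inducibility limit\<close>

lemma copies_le_choose: "finite (verts G) \<Longrightarrow> copies F G \<le> card (verts G) choose card (verts F)"
  unfolding copies_def
  by (rule order_trans[OF card_mono[where B = "[verts G]\<^bsup>card (verts F)\<^esup>"]])
     (auto simp: finite_imp_finite_nsets)

lemma finite_copies_set:
  "finite {copies F G |G :: (nat, 'c) cgraph. colored_complete T G \<and> card (verts G) = n}"
  by (rule finite_subset[where B = "{..n choose card (verts F)}"])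
     (auto simp: colored_complete_def intro: order_trans[OF copies_le_choose])

lemma copies_le_max_copies:
  fixes G :: "(nat, 'c) cgraph"
  shows "colored_complete T G \<Longrightarrow> card (verts G) = n \<Longrightarrow> copies F G \<le> max_copies T F n"
  unfolding max_copies_def by (rule Max_ge[OF finite_copies_set]) auto

lemma max_copies_attained:
  assumes "T \<noteq> {}"
  obtains G :: "(nat, 'c) cgraph" where "colored_complete T G" "card (verts G) = n"
    "copies F G = max_copies T F n"
proof -
  obtain t where "t \<in> T" using assms by auto
  then have "colored_complete T (\<lparr>verts = {..<n}, color = (\<lambda>_. t)\<rparr> :: (nat, 'c) cgraph)"
    by (auto simp: colored_complete_def)
  then have "copies F (\<lparr>verts = {..<n}, color = (\<lambda>_. t)\<rparr> :: (nat, 'c) cgraph)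
    \<in> {copies F G |G :: (nat, 'c) cgraph. colored_complete T G \<and> card (verts G) = n}" by force
  then have "max_copies T F n
    \<in> {copies F G |G :: (nat, 'c) cgraph. colored_complete T G \<and> card (verts G) = n}"
    unfolding max_copies_def by (intro Max_in finite_copies_set) auto
  then show thesis using that by auto
qed

lemma sum_copies_delete_vertex:
  assumes "finite (verts G)" and "card (verts F) \<le> card (verts G)"
  shows "(\<Sum>v\<in>verts G. copies F (induced G (verts G - {v}))) =
    copies F G * (card (verts G) - card (verts F))"
proof -
  let ?V = "verts G" and ?k = "card (verts F)"
  define A where "A = {S \<in> [?V]\<^bsup>?k\<^esup>. cg_iso (induced G S) F}"
  have finA: "finite A" using assms(1) by (auto simp: A_def finite_imp_finite_nsets)
  have c: "copies F (induced G (?V - {v})) = card {S \<in> A. v \<notin> S}" for v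
    unfolding copies_def A_def by (rule arg_cong[where f = card]) (auto simp: induced_def nsets_def)
  have "(\<Sum>v\<in>?V. card {S \<in> A. v \<notin> S}) = (\<Sum>S\<in>A. card {v \<in> ?V. v \<notin> S})"
    using assms(1) finA by (rule sum_multicount_gen) auto
  also have "\<dots> = (\<Sum>S\<in>A. card ?V - ?k)"
  proof (rule sum.cong[OF refl])
    fix S assume "S \<in> A"
    then have "S \<subseteq> ?V" "finite S" "card S = ?k" by (auto simp: A_def nsets_def)
    moreover have "{v \<in> ?V. v \<notin> S} = ?V - S" by auto
    ultimately show "card {v \<in> ?V. v \<notin> S} = card ?V - ?k" by (simp add: card_Diff_subset)
  qed
  finally show ?thesis unfolding c by (simp add: copies_def A_def)
qed

lemma ind_Suc_le:
  assumes "T \<noteq> {}" and "card (verts F) \<le> n"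
  shows "ind T F (Suc n) \<le> ind T F n"
proof -
  let ?k = "card (verts F)"
  obtain G :: "(nat, 'a) cgraph" where G: "colored_complete T G" "card (verts G) = Suc n"
    "copies F G = max_copies T F (Suc n)" using max_copies_attained[OF assms(1)] by blast
  then have fin: "finite (verts G)" by (simp add: colored_complete_def)
  have "copies F G * (Suc n - ?k) = (\<Sum>v\<in>verts G. copies F (induced G (verts G - {v})))"
    using sum_copies_delete_vertex[OF fin, of F] G(2) assms(2) by simp
  also have "\<dots> \<le> (\<Sum>v\<in>verts G. max_copies T F n)"
  proof (intro sum_mono copies_le_max_copies)
    fix v assume v: "v \<in> verts G"
    show "colored_complete T (induced G (verts G - {v}))"
      using G(1) by (auto simp: colored_complete_def induced_def nsets_def)
    show "card (verts (induced G (verts G - {v}))) = n"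
      using G(2) v fin by (simp add: induced_def)
  qed
  finally have le: "max_copies T F (Suc n) * (Suc n - ?k) \<le> Suc n * max_copies T F n"
    using G by simp
  have ch: "(Suc n - ?k) * (Suc n choose ?k) = Suc n * (n choose ?k)"
    using binomial_absorb_comp[of "Suc n" ?k] by simp
  have pos: "0 < Suc n choose ?k" "0 < n choose ?k" "0 < Suc n - ?k"
    using assms(2) by (auto simp: zero_less_binomial_iff)
  have "(Suc n - ?k) * (max_copies T F (Suc n) * (n choose ?k))
      \<le> Suc n * max_copies T F n * (n choose ?k)"
    using mult_right_mono[OF le, of "n choose ?k"] by (simp add: ac_simps)
  also have "\<dots> = (Suc n - ?k) * (max_copies T F n * (Suc n choose ?k))"
    using ch by (metis mult.assoc mult.commute)
  finally have "max_copies T F (Suc n) * (n choose ?k) \<le> max_copies T F n * (Suc n choose ?k)"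
    using pos(3) by simp
  then have "real (max_copies T F (Suc n)) * real (n choose ?k)
      \<le> real (max_copies T F n) * real (Suc n choose ?k)"
    by (metis of_nat_le_iff of_nat_mult)
  then show ?thesis using pos unfolding ind_def by (simp add: divide_simps)
qed

lemma convergent_ind:
  assumes "T \<noteq> {}"
  shows "convergent (ind T F)"
proof -
  let ?k = "card (verts F)"
  have "decseq (\<lambda>n. ind T F (n + ?k))"
    using ind_Suc_le[OF assms, of F] by (intro decseq_SucI) simp
  moreover have "0 \<le> ind T F (n + ?k)" for n by (simp add: ind_def)
  ultimately have "convergent (\<lambda>n. ind T F (n + ?k))"
    by (metis decseq_convergent convergentI)
  then show ?thesis by (simp add: convergent_ignore_initial_segment)
qed

end

theory Submission
  imports Defs "HOL-Library.Nat_Bijection" "HOL-Library.FuncSet"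
begin

text \<open>Let \<open>a\<close> be the inducibility divided by \<open>k!\<close>. Blowing up the vertices of a colored graph
  shows that, for all vertex weights, the weighted number of copies is at most \<open>a\<close> times the
  \<open>k\<close>-th power of the total weight. In an extremal graph on \<open>n\<close> vertices every vertex lies in
  about \<open>a k n\<^sup>k\<^sup>-\<^sup>1\<close> copies, so it plays some role \<open>i\<close> in at least \<open>a n\<^sup>k\<^sup>-\<^sup>1 / 2\<close> of them. Giving weight
  \<open>0\<close> to the vertices excluded by this role shows that there are only \<open>O(n log k / k)\<close> of them.
  In a copy where the vertex plays another role, all but one of its \<open>d \<ge> C log k\<close> or more neighbors
  are excluded ones. Tripling the weight of the excluded vertices costs a factor polynomial in
  \<open>k\<close> and gains about \<open>3\<^sup>d\<close>, so such copies are negligible, even among those through a second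
  prescribed vertex.

  Hence the roles partition the vertices into \<open>V\<^sub>1, \<dots>, V\<^sub>k\<close>. A copy without a wrongly colored
  pair between two parts is a transversal or lies inside one part, and the copies with a wrong
  pair are outnumbered by the transversals that the wrong pairs destroy. Thus
  \<open>I(n) \<le> \<Prod>|V\<^sub>i| + \<Sum>I(|V\<^sub>i|)\<close>, and \<open>(\<Sum>x\<^sub>i)\<^sup>k - \<Sum>x\<^sub>i\<^sup>k \<ge> (k\<^sup>k - k) \<Prod>x\<^sub>i\<close> gives
  \<open>a \<le> 1/(k\<^sup>k - k)\<close>.\<close>

section \<open>Copies and weights\<close>

definition copy_sets :: "('v, 'c) cgraph \<Rightarrow> ('w, 'c) cgraph \<Rightarrow> 'w set set" where
  "copy_sets F G = {S \<in> [verts G]\<^bsup>card (verts F)\<^esup>. cg_iso (induced G S) F}"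

lemma copies_eq_card: "copies F G = card (copy_sets F G)"
  by (simp add: copies_def copy_sets_def)

lemma finite_copy_sets: "finite (verts G) \<Longrightarrow> finite (copy_sets F G)"
  by (simp add: copy_sets_def finite_imp_finite_nsets)

lemma copy_setsD:
  assumes "S \<in> copy_sets F G"
  shows "S \<subseteq> verts G" "finite S" "card S = card (verts F)"
  using assms by (auto simp: copy_sets_def nsets_def)

lemma cg_iso_pullback:
  assumes "cg_iso (induced G S) F" and h: "bij_betw h X S"
    and col: "\<And>e. e \<in> [X]\<^bsup>2\<^esup> \<Longrightarrow> color G' e = color G (h ` e)"
  shows "cg_iso (induced G' X) F"
proof -
  obtain f where f: "bij_betw f S (verts F)" "\<And>e. e \<in> [S]\<^bsup>2\<^esup> \<Longrightarrow> color F (f ` e) = color G e"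
    using assms(1) by (auto simp: cg_iso_def induced_def)
  have "h ` e \<in> [S]\<^bsup>2\<^esup>" if "e \<in> [X]\<^bsup>2\<^esup>" for e
    using that h by (auto simp: nsets_def bij_betw_def card_image inj_on_subset)
  then have "color F ((f \<circ> h) ` e) = color G' e" if "e \<in> [X]\<^bsup>2\<^esup>" for e
    using that f(2)[of "h ` e"] col[OF that] by (simp add: image_comp)
  then show ?thesis
    using bij_betw_trans[OF h f(1)] by (auto simp: cg_iso_def induced_def)
qed

lemma card_UN_le_real:
  assumes "finite I" "\<And>i. i \<in> I \<Longrightarrow> real (card (A i)) \<le> b"
  shows "real (card (\<Union>i\<in>I. A i)) \<le> real (card I) * b"
proof -
  have "real (card (\<Union>i\<in>I. A i)) \<le> (\<Sum>i\<in>I. real (card (A i)))"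
    using card_UN_le[OF assms(1), of A] by (metis of_nat_le_iff of_nat_sum)
  also have "\<dots> \<le> real (card I) * b" using sum_bounded_above[of I "\<lambda>i. real (card (A i))" b] assms(2) by simp
  finally show ?thesis .
qed

lemma tendsto_choose_over_power:
  "(\<lambda>n. real (n choose k) / real n ^ k) \<longlonglongrightarrow> 1 / fact k"
proof -
  have "(\<lambda>n. (\<Prod>i<k. 1 - real i / real n) / fact k) \<longlonglongrightarrow> (\<Prod>i<k. 1 - 0) / fact k"
    by (intro tendsto_divide tendsto_prod tendsto_diff tendsto_const
        tendsto_divide_0[OF tendsto_const] filterlim_at_top_imp_at_infinity
        filterlim_real_sequentially) auto
  moreover have "\<forall>\<^sub>F n in sequentially.
    (\<Prod>i<k. 1 - real i / real n) / fact k = real (n choose k) / real n ^ k"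
  proof (rule eventually_sequentiallyI[of 1])
    fix n :: nat assume n: "1 \<le> n"
    have "real (n choose k) = (\<Prod>i<k. real n - real i) / fact k"
      by (simp add: binomial_gbinomial gbinomial_prod_rev atLeast0LessThan)
    also have "(\<Prod>i<k. real n - real i) = (\<Prod>i<k. real n * (1 - real i / real n))"
      using n by (intro prod.cong) (auto simp: field_simps)
    also have "\<dots> = real n ^ k * (\<Prod>i<k. 1 - real i / real n)"
      by (simp add: prod.distrib)
    finally show "(\<Prod>i<k. 1 - real i / real n) / fact k = real (n choose k) / real n ^ k"
      using n by simp
  qed
  ultimately show ?thesis by (simp add: filterlim_cong)
qed

section \<open>Weighted counting by blow-ups\<close>

text \<open>Replace every vertex \<open>v\<close> by \<open>w v\<close> clones. A copy together with
  one clone of each of its vertices is a copy in the blow-up, which has as many vertices as the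
  total weight; further copies only help.\<close>

lemma sum_weights_le_max_copies:
  fixes G :: "(nat, 'c) cgraph" and F :: "('v, 'c) cgraph" and w :: "nat \<Rightarrow> nat"
  assumes G: "colored_complete T G" and "T \<noteq> {}"
  shows "(\<Sum>S\<in>copy_sets F G. \<Prod>v\<in>S. w v) \<le> max_copies T F (\<Sum>v\<in>verts G. w v)"
proof -
  obtain t where t: "t \<in> T" using assms by auto
  \<comment> \<open>A clone is a pair of a vertex and an index, coded as a number because
    \<open>max_copies\<close> ranges over graphs on \<open>nat\<close>; \<open>h\<close> forgets the
    index.\<close>
  define h where "h = fst \<circ> prod_decode"
  define B where "B = (SIGMA v:verts G. {..<w v})"
  \<comment> \<open>Two clones of one vertex have a singleton image under \<open>h\<close>, which
    has no meaningful color in \<open>G\<close>; such pairs get the arbitrary color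
    \<open>t\<close>.\<close>
  define G' :: "(nat, 'c) cgraph" where
    "G' = \<lparr>verts = prod_encode ` B, color = (\<lambda>e. if card (h ` e) = 2 then color G (h ` e) else t)\<rparr>"
  define Q where "Q = (SIGMA S:copy_sets F G. PiE S (\<lambda>v. {..<w v}))"
  define lift where "lift = (\<lambda>(S, g). (\<lambda>v. prod_encode (v, g v)) ` S)"
  have finV: "finite (verts G)" using G by (simp add: colored_complete_def)
  have finB: "finite B" using finV by (simp add: B_def)
  have cc: "colored_complete T G'"
    unfolding colored_complete_def
  proof (intro conjI ballI)
    show "finite (verts G')" using finB by (simp add: G'_def)
    fix e assume "e \<in> [verts G']\<^bsup>2\<^esup>"
    then have "h ` e \<subseteq> verts G" "finite (h ` e)" by (auto simp: G'_def nsets_def h_def B_def)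
    then show "color G' e \<in> T"
      using G t by (auto simp: G'_def colored_complete_def nsets_def)
  qed
  have cardV: "card (verts G') = (\<Sum>v\<in>verts G. w v)"
    using finV by (simp add: G'_def card_image inj_prod_encode B_def)
  have h_lift: "h ` lift (S, g) = S" for S g
    by (auto simp: lift_def h_def image_image)
  have inj: "inj_on lift Q"
  proof (rule inj_onI)
    fix a b assume a: "a \<in> Q" and b: "b \<in> Q" and eq: "lift a = lift b"
    obtain S g S' g' where ab: "a = (S, g)" "b = (S', g')" by fastforce
    have S: "S = S'" using h_lift[of S g] h_lift[of S' g'] eq ab by simp
    have "g v = g' v" if "v \<in> S" for v
    proof -
      have "prod_encode (v, g v) \<in> lift b" using that eq ab by (auto simp: lift_def)
      then show ?thesis using ab by (auto simp: lift_def)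
    qed
    then have "g = g'" using a b ab S by (auto simp: Q_def intro: PiE_ext)
    then show "a = b" using ab S by simp
  qed
  have sub: "lift ` Q \<subseteq> copy_sets F G'"
  proof
    fix X assume "X \<in> lift ` Q"
    then obtain S g where X: "X = lift (S, g)" and S: "S \<in> copy_sets F G"
      and g: "g \<in> PiE S (\<lambda>v. {..<w v})" by (auto simp: Q_def)
    have injh: "inj_on h X" by (auto simp: X lift_def h_def inj_on_def)
    have bh: "bij_betw h X S" using injh h_lift[of S g] by (simp add: bij_betw_def X)
    have "X \<subseteq> verts G'" using copy_setsD(1)[OF S] g by (auto simp: X lift_def G'_def B_def)
    moreover have "finite X" using copy_setsD(2)[OF S] by (simp add: X lift_def)
    moreover have "card X = card (verts F)"
      using bij_betw_same_card[OF bh] copy_setsD(3)[OF S] by simp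
    moreover have "cg_iso (induced G' X) F"
    proof (rule cg_iso_pullback[OF _ bh])
      show "cg_iso (induced G S) F" using S by (simp add: copy_sets_def)
      fix e assume "e \<in> [X]\<^bsup>2\<^esup>"
      then have "card (h ` e) = 2" using injh by (auto simp: nsets_def card_image inj_on_subset)
      then show "color G' e = color G (h ` e)" by (simp add: G'_def)
    qed
    ultimately show "X \<in> copy_sets F G'" by (simp add: copy_sets_def nsets_def)
  qed
  have finC: "finite (copy_sets F G)" by (rule finite_copy_sets[OF finV])
  have "card Q = (\<Sum>S\<in>copy_sets F G. card (PiE S (\<lambda>v. {..<w v})))"
    unfolding Q_def using finC by (intro card_SigmaI) (auto intro!: finite_PiE dest: copy_setsD(2))
  also have "\<dots> = (\<Sum>S\<in>copy_sets F G. \<Prod>v\<in>S. w v)"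
    by (intro sum.cong refl) (simp add: card_PiE copy_setsD(2))
  finally have "(\<Sum>S\<in>copy_sets F G. \<Prod>v\<in>S. w v) = card (lift ` Q)"
    by (simp add: card_image[OF inj])
  also have "\<dots> \<le> copies F G'"
    unfolding copies_eq_card using sub cc
    by (intro card_mono finite_copy_sets) (auto simp: colored_complete_def)
  also have "\<dots> \<le> max_copies T F (\<Sum>v\<in>verts G. w v)"
    by (rule copies_le_max_copies[OF cc cardV])
  finally show ?thesis .
qed

text \<open>Multiplying all weights by \<open>t\<close> and letting \<open>t\<close> tend to infinity removes the lower order terms.\<close>

lemma sum_weights_le_inducibility:
  fixes G :: "(nat, 'c) cgraph" and F :: "('v, 'c) cgraph" and w :: "nat \<Rightarrow> nat"
  assumes G: "colored_complete T G" and T: "T \<noteq> {}" and k: "card (verts F) = k" "0 < k"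
  shows "(\<Sum>S\<in>copy_sets F G. \<Prod>v\<in>S. real (w v))
    \<le> inducibility T F / fact k * (\<Sum>v\<in>verts G. real (w v)) ^ k"
proof -
  define M where "M = (\<Sum>v\<in>verts G. w v)"
  define P where "P = (\<Sum>S\<in>copy_sets F G. \<Prod>v\<in>S. w v)"
  have fin: "finite (verts G)" using G by (simp add: colored_complete_def)
  have "real P \<le> inducibility T F / fact k * real M ^ k"
  proof (cases "M = 0")
    case True
    then have w0: "w v = 0" if "v \<in> verts G" for v using that fin by (auto simp: M_def)
    have "P = 0"
      unfolding P_def
    proof (rule sum.neutral, rule ballI)
      fix S assume S: "S \<in> copy_sets F G"
      then obtain v where "v \<in> S" using copy_setsD[OF S] k by fastforce
      then show "(\<Prod>v\<in>S. w v) = 0" using copy_setsD[OF S] w0 by (intro prod_zero) auto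
    qed
    then show ?thesis using True k by (simp add: zero_power)
  next
    case False
    have scaled: "t ^ k * P \<le> max_copies T F (t * M)" for t
    proof -
      have "(\<Sum>S\<in>copy_sets F G. \<Prod>v\<in>S. t * w v) = t ^ k * P"
        unfolding P_def sum_distrib_left
        by (intro sum.cong refl) (simp add: prod.distrib copy_setsD(3) k)
      then show ?thesis
        using sum_weights_le_max_copies[OF G T, where F = F and w = "\<lambda>v. t * w v"]
        by (simp add: M_def sum_distrib_left)
    qed
    \<comment> \<open>Scaling reaches only the sizes \<open>Suc n * M\<close>; being positive
      multiples of \<open>M\<close>, they tend to infinity, so the limits carry over.\<close>
    have lim: "filterlim (\<lambda>n. Suc n * M) at_top sequentially"
      using False by (intro filterlim_subseq) (auto simp: strict_mono_def)
    have "(\<lambda>n. ind T F n * (real (n choose k) / real n ^ k)) \<longlonglongrightarrow> inducibility T F * (1 / fact k)"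
      using convergent_LIMSEQ_iff[of "ind T F"] convergent_ind[OF T, of F]
      by (intro tendsto_mult tendsto_choose_over_power) (simp add: inducibility_def)
    from filterlim_compose[OF this lim]
    have l: "(\<lambda>n. ind T F (Suc n * M) * (real (Suc n * M choose k) / real (Suc n * M) ^ k))
      \<longlonglongrightarrow> inducibility T F / fact k" by simp
    have "real P / real M ^ k \<le> ind T F (Suc n * M) * (real (Suc n * M choose k) / real (Suc n * M) ^ k)"
      if n: "k \<le> n" for n
    proof -
      have "n \<le> Suc n * M" using False by (cases M) auto
      then have pos: "0 < Suc n * M choose k" using n by (auto simp: zero_less_binomial_iff)
      have "real (Suc n ^ k * P) \<le> real (max_copies T F (Suc n * M))"
        using scaled[of "Suc n"] by (simp only: of_nat_le_iff)
      then have "real (Suc n ^ k * P) / real (Suc n * M) ^ k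
          \<le> real (max_copies T F (Suc n * M)) / real (Suc n * M) ^ k"
        by (rule divide_right_mono) simp
      moreover have "real (Suc n ^ k * P) / real (Suc n * M) ^ k = real P / real M ^ k"
        by (simp add: power_mult_distrib del: mult_Suc of_nat_Suc)
      ultimately have "real P / real M ^ k
          \<le> real (max_copies T F (Suc n * M)) / real (Suc n * M) ^ k" by simp
      also have "\<dots> = ind T F (Suc n * M) * (real (Suc n * M choose k) / real (Suc n * M) ^ k)"
        using pos by (simp add: ind_def k del: mult_Suc)
      finally show ?thesis .
    qed
    then have "real P / real M ^ k \<le> inducibility T F / fact k"
      using l by (intro LIMSEQ_le_const[of _ _ "real P / real M ^ k"]) auto
    then show ?thesis using False by (simp add: field_simps)
  qed
  then show ?thesis by (simp add: P_def M_def)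
qed

text \<open>An averaging form of the weight inequality: a family of copies with uniformly large
  weight products cannot be large. The later counting bounds differ only in the weights and the
  family.\<close>

lemma card_copies_le_weights:
  fixes G :: "(nat, 'c) cgraph" and F :: "('v, 'c) cgraph" and w :: "nat \<Rightarrow> nat"
  assumes G: "colored_complete T G" and T: "T \<noteq> {}" and k: "card (verts F) = k" "0 < k"
    and \<S>: "\<S> \<subseteq> copy_sets F G" "\<And>S. S \<in> \<S> \<Longrightarrow> L \<le> (\<Prod>v\<in>S. real (w v))"
  shows "real (card \<S>) * L \<le> inducibility T F / fact k * (\<Sum>v\<in>verts G. real (w v)) ^ k"
proof -
  have fin: "finite (copy_sets F G)"
    using G by (simp add: colored_complete_def finite_copy_sets)
  have "real (card \<S>) * L = (\<Sum>S\<in>\<S>. L)" by simp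
  also have "\<dots> \<le> (\<Sum>S\<in>\<S>. \<Prod>v\<in>S. real (w v))" by (intro sum_mono \<S>)
  also have "\<dots> \<le> (\<Sum>S\<in>copy_sets F G. \<Prod>v\<in>S. real (w v))"
    using \<S>(1) fin by (intro sum_mono2) (auto intro: prod_nonneg)
  also have "\<dots> \<le> inducibility T F / fact k * (\<Sum>v\<in>verts G. real (w v)) ^ k"
    by (rule sum_weights_le_inducibility[OF G T k])
  finally show ?thesis .
qed

lemma max_copies_le_inducibility:
  fixes F :: "('v, 'c) cgraph"
  assumes T: "T \<noteq> {}" and k: "card (verts F) = k" "0 < k"
  shows "real (max_copies T F n) \<le> inducibility T F / fact k * real n ^ k"
proof -
  obtain G :: "(nat, 'c) cgraph" where G: "colored_complete T G" "card (verts G) = n"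
    "copies F G = max_copies T F n" using max_copies_attained[OF T] by blast
  show ?thesis
    using card_copies_le_weights[OF G(1) T k subset_refl, of 1 "\<lambda>_. 1"] G
    by (simp add: copies_eq_card)
qed

lemma inducibility_le_max_copies:
  fixes F :: "('v, 'c) cgraph"
  assumes T: "T \<noteq> {}" and k: "card (verts F) = k" "k \<le> n"
  shows "inducibility T F * real (n choose k) \<le> real (max_copies T F n)"
proof -
  have "ind T F (m + n) \<le> ind T F n" for m
  proof (induction m)
    case (Suc m)
    then show ?case using ind_Suc_le[OF T, of F "m + n"] k by simp
  qed simp
  moreover have "ind T F \<longlonglongrightarrow> inducibility T F"
    using convergent_ind[OF T, of F] by (simp add: inducibility_def convergent_LIMSEQ_iff)
  then have "(\<lambda>m. ind T F (m + n)) \<longlonglongrightarrow> inducibility T F" by (rule LIMSEQ_ignore_initial_segment)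
  ultimately have "inducibility T F \<le> ind T F n" by (auto intro: LIMSEQ_le_const2)
  moreover have "0 < n choose k" using k by (simp add: zero_less_binomial_iff)
  ultimately show ?thesis using k by (simp add: ind_def field_simps)
qed

text \<open>Zykov symmetrization: recolor \<open>v\<close> as a clone of \<open>u\<close>.\<close>

lemma extremal_degree_le:
  fixes G :: "(nat, 'c) cgraph" and F :: "('v, 'c) cgraph"
  assumes G: "colored_complete T G" and ext: "copies F G = max_copies T F (card (verts G))"
    and uv: "u \<in> verts G" "v \<in> verts G" "u \<noteq> v"
  shows "card {S \<in> copy_sets F G. u \<in> S}
    \<le> card {S \<in> copy_sets F G. v \<in> S} + card {S \<in> copy_sets F G. u \<in> S \<and> v \<in> S}"
proof -
  define G' where "G' = \<lparr>verts = verts G,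
    color = (\<lambda>e. color G (if v \<in> e \<and> u \<notin> e then insert u (e - {v}) else e))\<rparr>"
  let ?C = "copy_sets F G"
  \<comment> \<open>Copies avoiding \<open>v\<close> survive in \<open>G'\<close>, and each of them
    through \<open>u\<close> yields a second copy with \<open>v\<close> in place of
    \<open>u\<close>. Extremality of \<open>G\<close> bounds the total.\<close>
  define A where "A = {S \<in> ?C. v \<notin> S}"
  define B where "B = {S \<in> ?C. u \<in> S \<and> v \<notin> S}"
  define sh where "sh = (\<lambda>S. insert v (S - {u}))"
  have fin: "finite ?C" "finite (verts G)" using G by (auto simp: colored_complete_def finite_copy_sets)
  have cc: "colored_complete T G'"
    unfolding colored_complete_def
  proof (intro conjI ballI)
    show "finite (verts G')" using fin by (simp add: G'_def)
    fix e assume "e \<in> [verts G']\<^bsup>2\<^esup>"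
    then have e: "e \<subseteq> verts G" "finite e" "card e = 2" by (auto simp: nsets_def G'_def)
    then have "insert u (e - {v}) \<in> [verts G]\<^bsup>2\<^esup>" if "v \<in> e" "u \<notin> e"
      using that uv by (auto simp: nsets_def)
    then show "color G' e \<in> T"
      using G e by (auto simp: colored_complete_def G'_def nsets_def)
  qed
  have "A \<subseteq> copy_sets F G'"
  proof
    fix S assume S: "S \<in> A"
    have "cg_iso (induced G' S) F"
      by (rule cg_iso_pullback[of G S F id]) (use S in \<open>auto simp: A_def copy_sets_def G'_def nsets_def\<close>)
    then show "S \<in> copy_sets F G'" using S by (simp add: A_def copy_sets_def G'_def)
  qed
  moreover have "sh ` B \<subseteq> copy_sets F G'"
  proof
    fix X assume "X \<in> sh ` B"
    then obtain S where S: "S \<in> B" and X: "X = sh S" by auto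
    then have SC: "S \<in> ?C" and uS: "u \<in> S" and vS: "v \<notin> S" by (auto simp: B_def)
    define h where "h = (\<lambda>x. if x = v then u else x)"
    have h: "bij_betw h X S"
      unfolding bij_betw_def using uS vS by (auto simp: X sh_def h_def inj_on_def)
    have "cg_iso (induced G' X) F"
    proof (rule cg_iso_pullback[OF _ h])
      show "cg_iso (induced G S) F" using SC by (simp add: copy_sets_def)
      fix e assume "e \<in> [X]\<^bsup>2\<^esup>"
      then have "u \<notin> e" using uv(3) by (auto simp: nsets_def X sh_def)
      moreover have "h ` e = (if v \<in> e then insert u (e - {v}) else e)"
        by (auto simp: h_def)
      ultimately show "color G' e = color G (h ` e)" by (simp add: G'_def)
    qed
    moreover have "X \<subseteq> verts G" "finite X" "card X = card (verts F)"
      using copy_setsD[OF SC] bij_betw_same_card[OF h] uv by (auto simp: X sh_def)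
    ultimately show "X \<in> copy_sets F G'" by (simp add: copy_sets_def nsets_def G'_def)
  qed
  moreover have "A \<inter> sh ` B = {}" by (auto simp: A_def sh_def)
  moreover have "inj_on sh B"
  proof (rule inj_onI)
    fix S S' assume "S \<in> B" "S' \<in> B" "sh S = sh S'"
    then show "S = S'" unfolding B_def sh_def by (auto; blast)
  qed
  ultimately have "card A + card B \<le> copies F G'"
    using card_mono[of "copy_sets F G'" "A \<union> sh ` B"] fin cc
    by (simp add: copies_eq_card card_Un_disjoint card_image A_def B_def finite_copy_sets
        colored_complete_def)
  also have "\<dots> \<le> copies F G"
    using copies_le_max_copies[OF cc refl, of F] ext by (simp add: G'_def)
  finally have "card A + card B \<le> card ?C" by (simp add: copies_eq_card)
  moreover have "card ?C = card A + card {S \<in> ?C. v \<in> S}"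
    using fin by (subst card_Un_disjoint[symmetric]) (auto simp: A_def intro!: arg_cong[where f = card])
  moreover have "card {S \<in> ?C. u \<in> S} = card B + card {S \<in> ?C. u \<in> S \<and> v \<in> S}"
    using fin by (subst card_Un_disjoint[symmetric]) (auto simp: B_def intro!: arg_cong[where f = card])
  ultimately show ?thesis by linarith
qed

section \<open>A polynomial inequality\<close>

text \<open>Expand the power into \<open>k ^ k\<close> monomials. Apart from the \<open>k\<close> pure powers, their geometric
  mean is the product of all variables.\<close>

lemma power_sum_minus_sum_powers_ge:
  fixes x :: "'i \<Rightarrow> real"
  assumes I: "finite I" "card I = k" "0 < k" and pos: "\<And>i. i \<in> I \<Longrightarrow> 0 < x i"
  shows "(real k ^ k - real k) * (\<Prod>i\<in>I. x i) \<le> (\<Sum>i\<in>I. x i) ^ k - (\<Sum>i\<in>I. x i ^ k)"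
proof -
  \<comment> \<open>Functions in \<open>\<G>\<close> index the monomials of the expanded power; the
    constant ones, forming \<open>K\<close>, give the pure powers.\<close>
  define \<G> where "\<G> = (PiE I (\<lambda>_. I))"
  define K where "K = (\<lambda>i. \<lambda>t\<in>I. i) ` I"
  define m where "m = (\<lambda>g. \<Prod>t\<in>I. x (g t))"
  define p where "p = (\<Prod>i\<in>I. x i)"
  define l where "l = (\<Sum>i\<in>I. ln (x i))"
  have I0: "I \<noteq> {}" using I by auto
  have p: "0 < p" "ln p = l" unfolding p_def l_def using I pos by (auto intro!: prod_pos ln_prod simp: less_imp_neq[symmetric])
  have fin: "finite \<G>" unfolding \<G>_def using I by (intro finite_PiE) auto
  have K\<G>: "K \<subseteq> \<G>" by (auto simp: K_def \<G>_def)
  have injK: "inj_on (\<lambda>i. \<lambda>t\<in>I. i) I"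
    using I0 by (auto simp: inj_on_def restrict_def fun_eq_iff; meson)
  have mpos: "0 < m g" if "g \<in> \<G>" for g
    unfolding m_def using that pos by (intro prod_pos) (auto simp: \<G>_def)
  have lnm: "ln (m g) = (\<Sum>t\<in>I. ln (x (g t)))" if "g \<in> \<G>" for g
  proof -
    have "0 < x (g t)" if "t \<in> I" for t using that \<open>g \<in> \<G>\<close> pos by (auto simp: \<G>_def)
    then show ?thesis unfolding m_def using I by (intro ln_prod) (auto simp: less_imp_neq[symmetric])
  qed
  have all: "(\<Sum>g\<in>\<G>. m g) = (\<Sum>i\<in>I. x i) ^ k"
    using prod_sum_PiE[of I "\<lambda>_. I" "\<lambda>_ i. x i"] I by (simp add: m_def \<G>_def)
  have pure: "(\<Sum>g\<in>K. m g) = (\<Sum>i\<in>I. x i ^ k)"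
    unfolding K_def by (subst sum.reindex[OF injK]) (simp add: m_def I)
  have marg: "(\<Sum>g\<in>\<G>. ln (x (g t))) = real k ^ (k - 1) * l" if t: "t \<in> I" for t
  proof -
    have "(\<Prod>s\<in>I. \<Sum>i\<in>I. if s = t then ln (x i) else 1)
        = (\<Sum>g\<in>\<G>. \<Prod>s\<in>I. if s = t then ln (x (g s)) else 1)"
      using prod_sum_PiE[of I "\<lambda>_. I" "\<lambda>s i. if s = t then ln (x i) else 1"] I by (simp add: \<G>_def)
    also have "\<dots> = (\<Sum>g\<in>\<G>. ln (x (g t)))"
      using I t by (simp add: prod.delta)
    finally have "(\<Sum>g\<in>\<G>. ln (x (g t))) = (\<Prod>s\<in>I. \<Sum>i\<in>I. if s = t then ln (x i) else 1)" by simp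
    also have "\<dots> = l * (\<Prod>s\<in>I - {t}. \<Sum>i\<in>I. if s = t then ln (x i) else 1)"
      using I t by (subst prod.remove[of I t]) (auto simp: l_def)
    also have "(\<Prod>s\<in>I - {t}. \<Sum>i\<in>I. if s = t then ln (x i) else 1) = (\<Prod>s\<in>I - {t}. real k)"
      using I by (intro prod.cong) auto
    finally show ?thesis using I t by simp
  qed
  have kk: "real k * real k ^ (k - 1) = real k ^ k" using I by (simp flip: power_Suc)
  have "(\<Sum>g\<in>\<G>. ln (m g)) = (\<Sum>t\<in>I. \<Sum>g\<in>\<G>. ln (x (g t)))"
    by (simp add: lnm sum.swap[of _ I])
  also have "\<dots> = real k ^ k * l"
    using I by (simp add: marg flip: kk)
  finally have ln_all: "(\<Sum>g\<in>\<G>. ln (m g)) = real k ^ k * l" .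
  have ln_pure: "(\<Sum>g\<in>K. ln (m g)) = real k * l"
    unfolding K_def using pos
    by (subst sum.reindex[OF injK]) (simp add: m_def I ln_realpow l_def sum_distrib_left)
  have cards: "real (card (\<G> - K)) = real k ^ k - real k"
  proof -
    have "card \<G> = k ^ k" "card K = k" using I card_image[OF injK] by (auto simp: \<G>_def K_def card_PiE)
    moreover have "card K \<le> card \<G>" using K\<G> fin by (rule card_mono[rotated])
    ultimately show ?thesis using K\<G> fin by (simp add: card_Diff_subset finite_subset of_nat_diff)
  qed
  \<comment> \<open>The arithmetic-geometric mean inequality in tangent form at the mean
    \<open>p\<close>, whose logarithm is \<open>l\<close>. Summed over the mixed monomials, the
    terms \<open>ln (m g) - l\<close> cancel.\<close>
  have tangent: "p * (1 + ln (m g) - l) \<le> m g" if "g \<in> \<G>" for g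
  proof -
    have "ln (m g / p) \<le> m g / p - 1" using mpos[OF that] p by (intro ln_le_minus_one) simp
    then have "1 + ln (m g) - l \<le> m g / p" using mpos[OF that] p by (simp add: ln_div)
    then show ?thesis using p by (simp add: field_simps)
  qed
  have "(\<Sum>g\<in>\<G> - K. p * (1 + ln (m g) - l)) \<le> (\<Sum>g\<in>\<G> - K. m g)"
    by (intro sum_mono tangent) auto
  also have "\<dots> = (\<Sum>i\<in>I. x i) ^ k - (\<Sum>i\<in>I. x i ^ k)"
    using fin K\<G> by (simp add: sum_diff all pure)
  also have "(\<Sum>g\<in>\<G> - K. p * (1 + ln (m g) - l))
      = p * (real (card (\<G> - K)) * (1 - l) + (\<Sum>g\<in>\<G> - K. ln (m g)))"
    by (simp add: sum_distrib_left[symmetric] sum.distrib sum_subtractf algebra_simps)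
  also have "(\<Sum>g\<in>\<G> - K. ln (m g)) = (real k ^ k - real k) * l"
    using fin K\<G> by (simp add: sum_diff ln_all ln_pure algebra_simps)
  finally show ?thesis by (simp add: cards p_def algebra_simps)
qed

section \<open>Rigidity\<close>

definition rcol :: "'v set set \<Rightarrow> 'v set \<Rightarrow> 'v set" where
  "rcol E e = (if e \<in> E then e else {})"

text \<open>An edge color belongs to a single pair, so an edge with differently labeled ends must be
  mapped to itself. A second edge at an end excludes a swap, and fixedness spreads through the
  connected graph. If every edge has equally labeled ends, connectedness leaves only a
  constant.\<close>

lemma rigid_labeling:
  assumes conn: "graph_connected V E" and E: "E \<subseteq> [V]\<^bsup>2\<^esup>"
    and deg: "\<And>a b. {a, b} \<in> E \<Longrightarrow> \<exists>c. c \<noteq> a \<and> {b, c} \<in> E"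
    and \<tau>: "\<And>a b. a \<in> V \<Longrightarrow> b \<in> V \<Longrightarrow> a \<noteq> b \<Longrightarrow> \<tau> a \<noteq> \<tau> b \<Longrightarrow> rcol E {a, b} = rcol E {\<tau> a, \<tau> b}"
  shows "(\<forall>a\<in>V. \<tau> a = a) \<or> (\<exists>c. \<forall>a\<in>V. \<tau> a = c)"
proof (cases "\<forall>a b. {a, b} \<in> E \<longrightarrow> \<tau> a = \<tau> b")
  case True
  obtain r where r: "r \<in> V" using conn by (auto simp: graph_connected_def)
  have "\<tau> r = \<tau> a" if "(r, a) \<in> {(x, y). {x, y} \<in> E}\<^sup>*" for a
    using that by induction (use True in auto)
  then show ?thesis using conn r by (metis graph_connected_def)
next
  case False
  have inV: "a \<in> V" "b \<in> V" "a \<noteq> b" if "{a, b} \<in> E" for a b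
    using subsetD[OF E that] by simp_all
  have edge: "{\<tau> a, \<tau> b} = {a, b}" if "{a, b} \<in> E" "\<tau> a \<noteq> \<tau> b" for a b
    using \<tau>[of a b] inV[OF that(1)] that by (auto simp: rcol_def split: if_splits)
  \<comment> \<open>Here \<open>{a, c}\<close> would have to carry the color \<open>{a, b}\<close>,
    which only the edge \<open>{a, b}\<close> has.\<close>
  have clash: False if "{a, b} \<in> E" "{b, c} \<in> E" "c \<noteq> a" "{\<tau> a, \<tau> c} = {a, b}" for a b c
  proof -
    have "a \<in> V" "c \<in> V" "a \<noteq> b" using inV that(1,2) by auto
    moreover have "\<tau> a \<noteq> \<tau> c" using that(4) \<open>a \<noteq> b\<close> by (auto simp: doubleton_eq_iff)
    ultimately have "rcol E {a, c} = {a, b}" using \<tau>[of a c] that by (auto simp: rcol_def)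
    then have "{a, c} = {a, b}" by (auto simp: rcol_def split: if_splits)
    then show False using inV[OF that(2)] by (auto simp: doubleton_eq_iff)
  qed
  \<comment> \<open>After a swap, a further edge \<open>{b, c}\<close> forces
    \<open>\<tau> c = a\<close>, since otherwise \<open>\<tau> b = a\<close> would lie in
    \<open>{b, c}\<close>; then \<open>{a, c}\<close> clashes.\<close>
  have no_swap: "\<tau> a = a \<and> \<tau> b = b" if ab: "{a, b} \<in> E" "\<tau> a \<noteq> \<tau> b" for a b
  proof (rule ccontr)
    assume "\<not> ?thesis"
    then have sw: "\<tau> a = b" "\<tau> b = a" using edge[OF ab] by (auto simp: doubleton_eq_iff)
    obtain c where c: "c \<noteq> a" "{b, c} \<in> E" using deg[OF ab(1)] by auto
    have "\<tau> c = a"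
      using edge[OF c(2)] sw c inV[OF ab(1)] by (cases "\<tau> c = a") (auto simp: doubleton_eq_iff)
    then show False using clash[OF ab(1) c(2,1)] sw by (simp add: insert_commute)
  qed
  have fixed_step: "\<tau> c = c" if "{a, b} \<in> E" "\<tau> a = a" "\<tau> b = b" "{b, c} \<in> E" for a b c
  proof (cases "c = a")
    case False
    have "\<tau> c \<noteq> b" using clash[OF that(1,4) False] that(2) by auto
    then show ?thesis using no_swap[OF that(4)] that(3) by auto
  qed (use that in auto)
  obtain a b where ab: "{a, b} \<in> E" "\<tau> a = a" "\<tau> b = b" using False no_swap by blast
  \<comment> \<open>The induction also carries a fixed neighbor of \<open>c\<close>, because
    \<open>fixed_step\<close> starts from a fixed edge.\<close>
  have "\<tau> c = c \<and> (\<exists>b. {b, c} \<in> E \<and> \<tau> b = b)" if "(b, c) \<in> {(x, y). {x, y} \<in> E}\<^sup>*" for c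
    using that
  proof induction
    case base
    then show ?case using ab by auto
  next
    case (step c e)
    then show ?case using fixed_step[of _ c e] by blast
  qed
  moreover have "b \<in> V" using inV[OF ab(1)] by simp
  ultimately show ?thesis using conn by (simp add: graph_connected_def)
qed

section \<open>Copies of a dense rainbow graph\<close>

text \<open>In \<open>degree_large\<close>, \<open>3 ^ d\<close> is, up to a factor
  \<open>9\<close>, the gain from tripling the weight of \<open>d - 2\<close> vertices, and
  \<open>k ^ 7\<close> combines a loss of \<open>k ^ 4\<close> with a required saving of
  \<open>k ^ 3\<close>.\<close>

locale dense_rainbow =
  fixes k :: nat and E :: "nat set set" and d :: nat
  assumes k2: "2 \<le> k"
    and edges: "E \<subseteq> [{1..k}]\<^bsup>2\<^esup>"
    and connected: "graph_connected {1..k} E"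
    and degree_ge: "\<And>i. i \<in> {1..k} \<Longrightarrow> d \<le> vertex_degree E i"
    and degree_large: "12000 * real k ^ 7 \<le> 3 ^ d"
begin

abbreviation R :: "(nat, nat set) cgraph" where "R \<equiv> rainbow k E"
abbreviation T :: "nat set set" where "T \<equiv> rainbow_colors E"

text \<open>The \<open>a\<close> of the overview. Normalizing by \<open>n ^ k\<close> instead of the
  binomial coefficient makes the weight bound homogeneous.\<close>

definition dens :: real where "dens = inducibility T R / fact k"

definition nbrs :: "nat \<Rightarrow> nat set" where "nbrs i = {j. {i, j} \<in> E}"

definition embeds :: "(nat, nat set) cgraph \<Rightarrow> nat set \<Rightarrow> (nat \<Rightarrow> nat) \<Rightarrow> bool" where
  "embeds G S f \<longleftrightarrow> bij_betw f S {1..k} \<and>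
     (\<forall>x\<in>S. \<forall>y\<in>S. x \<noteq> y \<longrightarrow> color G {x, y} = rcol E {f x, f y})"

definition role_copies :: "(nat, nat set) cgraph \<Rightarrow> nat \<Rightarrow> nat \<Rightarrow> nat set set" where
  "role_copies G v i = {S \<in> copy_sets R G. v \<in> S \<and> (\<exists>f. embeds G S f \<and> f v = i)}"

text \<open>The vertices that lie in no copy in which \<open>v\<close> plays the role \<open>i\<close>.\<close>

definition excluded :: "(nat, nat set) cgraph \<Rightarrow> nat \<Rightarrow> nat \<Rightarrow> nat set" where
  "excluded G v i = {z \<in> verts G - {v}. color G {v, z} \<noteq> {} \<and> i \<notin> color G {v, z}}"

lemma verts_R: "verts R = {1..k}"
  by (simp add: rainbow_def)

lemma T_nonempty: "T \<noteq> {}" and card_verts_R: "card (verts R) = k" and k_pos: "0 < k"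
  using k2 by (auto simp: rainbow_colors_def rainbow_def)

lemma colored_complete_R: "colored_complete T R"
  by (auto simp: colored_complete_def rainbow_def rainbow_colors_def)

lemma d_ge: "2 \<le> d"
proof (rule ccontr)
  assume "\<not> 2 \<le> d"
  then have "(3::real) ^ d \<le> 3" using power_increasing[of d 1 "3::real"] by simp
  moreover have "1 \<le> real k ^ 7" using k2 by (intro one_le_power) auto
  ultimately show False using degree_large by linarith
qed

lemma edgeD: "{i, j} \<in> E \<Longrightarrow> i \<in> {1..k} \<and> j \<in> {1..k} \<and> i \<noteq> j"
  using edges by (metis doubleton_in_nsets_2 subsetD)

lemma card_nbrs: assumes "i \<in> {1..k}" shows "d \<le> card (nbrs i)"
proof -
  have "{e \<in> E. i \<in> e} = (\<lambda>j. {i, j}) ` nbrs i"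
  proof (intro equalityI subsetI)
    fix e assume "e \<in> {e \<in> E. i \<in> e}"
    then have e: "e \<in> E" "i \<in> e" "card e = 2" using edges by (auto simp: nsets_def)
    then obtain j where "e = {i, j}" by (auto simp: card_2_iff)
    then show "e \<in> (\<lambda>j. {i, j}) ` nbrs i" using e by (auto simp: nbrs_def)
  qed (auto simp: nbrs_def)
  moreover have "inj_on (\<lambda>j. {i, j}) (nbrs i)" by (auto simp: inj_on_def doubleton_eq_iff)
  ultimately show ?thesis using degree_ge[OF assms] by (simp add: vertex_degree_def card_image)
qed

lemma nbrs_subset: "nbrs i \<subseteq> {1..k}"
  using edgeD by (auto simp: nbrs_def)

lemma copy_sets_iff: "S \<in> copy_sets R G \<longleftrightarrow> S \<subseteq> verts G \<and> (\<exists>f. embeds G S f)"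
proof -
  have pairs: "(\<forall>e\<in>[S]\<^bsup>2\<^esup>. color R (f ` e) = color G e) \<longleftrightarrow>
      (\<forall>x\<in>S. \<forall>y\<in>S. x \<noteq> y \<longrightarrow> color G {x, y} = rcol E {f x, f y})" for f
    by (auto simp: nsets_2_eq rainbow_def rcol_def)
  have iso: "cg_iso (induced G S) R \<longleftrightarrow> (\<exists>f. embeds G S f)"
    unfolding cg_iso_def embeds_def by (simp add: induced_def pairs verts_R)
  have "finite S \<and> card S = k" if "embeds G S f" for f
    using that bij_betw_finite[of f S "{1..k}"] bij_betw_same_card[of f S "{1..k}"]
    by (simp add: embeds_def)
  then show ?thesis
    unfolding copy_sets_def mem_Collect_eq iso card_verts_R nsets_def by blast
qed

lemma embedsD:
  assumes "embeds G S f"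
  shows "bij_betw f S {1..k}" "finite S" "card S = k"
    and "\<And>x y. x \<in> S \<Longrightarrow> y \<in> S \<Longrightarrow> x \<noteq> y \<Longrightarrow> color G {x, y} = rcol E {f x, f y}"
  using assms bij_betw_finite[of f S "{1..k}"] bij_betw_same_card[of f S "{1..k}"]
  by (auto simp: embeds_def)

section \<open>Copies through one or two prescribed vertices\<close>

lemma card_copies_le_dens:
  fixes G :: "(nat, nat set) cgraph"
  assumes "colored_complete T G" "\<S> \<subseteq> copy_sets R G"
    and "\<And>S. S \<in> \<S> \<Longrightarrow> L \<le> (\<Prod>v\<in>S. real (w v))"
  shows "real (card \<S>) * L \<le> dens * (\<Sum>v\<in>verts G. real (w v)) ^ k"
  unfolding dens_def by (rule card_copies_le_weights[OF assms(1) T_nonempty card_verts_R k_pos assms(2,3)])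

lemma max_copies_le_dens: "real (max_copies T R n) \<le> dens * real n ^ k"
  unfolding dens_def by (rule max_copies_le_inducibility[OF T_nonempty card_verts_R k_pos])

lemma dens_nonneg: "0 \<le> dens"
  using max_copies_le_dens[of 1] by (simp add: order_trans[OF of_nat_0_le_iff])

text \<open>With basic weight \<open>k\<close> the total weight is \<open>k * n\<close> up to a
  deviation \<open>t * n\<close>; the relative change \<open>1 + t / k\<close> costs at most
  \<open>exp t\<close> in the \<open>k\<close>-th power.\<close>

lemma weight_power_le_exp:
  assumes n: "0 < n" and t: "- real k \<le> t" and W: "0 \<le> W" "W \<le> real k * n + t * n"
  shows "W ^ k \<le> (real k * n) ^ k * exp t"
proof -
  have "W ^ k \<le> (real k * n + t * n) ^ k" by (rule power_mono[OF W(2,1)])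
  also have "real k * n + t * n = (real k * n) * (1 + t / real k)" using k_pos by (simp add: field_simps)
  also have "\<dots> ^ k = (real k * n) ^ k * (1 + t / real k) ^ k" by (rule power_mult_distrib)
  also have "\<dots> \<le> (real k * n) ^ k * exp t"
    using n t k_pos by (intro mult_left_mono exp_ge_one_plus_x_over_n_power_n) auto
  finally show ?thesis .
qed

text \<open>Every edge of a copy at \<open>v\<close> has a color containing the role of
  \<open>v\<close>. So copies with \<open>v\<close> in role \<open>i\<close> avoid the excluded
  vertices and keep their weight products when these get weight \<open>0\<close>; the lost total
  weight yields the exponential factor.\<close>

lemma card_role_copies_le:
  assumes G: "colored_complete T G" and v: "v \<in> verts G" and n: "card (verts G) = n"
  shows "real (card (role_copies G v i))
    \<le> dens * real k * real n ^ (k - 1) * exp (1 - real k * real (card (excluded G v i)) / real n)"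
proof -
  let ?O = "excluded G v i"
  define w where "w = (\<lambda>z. if z = v then n else if z \<in> ?O then 0 else k)"
  have fin: "finite (verts G)" using G by (simp add: colored_complete_def)
  have n0: "0 < n" using v n fin by (auto simp: card_gt_0_iff)
  have O: "?O \<subseteq> verts G" by (auto simp: excluded_def)
  have cO: "card ?O \<le> n" using card_mono[OF fin O] n by simp
  have prod: "real n * real k ^ (k - 1) \<le> (\<Prod>z\<in>S. real (w z))" if S: "S \<in> role_copies G v i" for S
  proof -
    obtain f where f: "embeds G S f" "f v = i" "v \<in> S" using S by (auto simp: role_copies_def)
    have "z \<notin> ?O" if "z \<in> S" for z
    proof
      assume "z \<in> ?O"
      then have "color G {v, z} = rcol E {i, f z}" "color G {v, z} \<noteq> {}" "i \<notin> color G {v, z}"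
        using embedsD(4)[OF f(1,3) that] f(2) by (auto simp: excluded_def)
      then show False by (auto simp: rcol_def split: if_splits)
    qed
    then have "(\<Prod>z\<in>S - {v}. real (w z)) = (\<Prod>z\<in>S - {v}. real k)"
      by (intro prod.cong) (auto simp: w_def)
    then have "(\<Prod>z\<in>S. real (w z)) = real n * real k ^ (k - 1)"
      using embedsD(2,3)[OF f(1)] f(3) by (subst prod.remove[of S v]) (auto simp: w_def)
    then show ?thesis by simp
  qed
  have "(\<Sum>z\<in>verts G. real (w z)) = real n + (\<Sum>z\<in>verts G - {v}. real (w z))"
    using fin v by (subst sum.remove[of _ v]) (auto simp: w_def)
  also have "(\<Sum>z\<in>verts G - {v}. real (w z)) \<le> (\<Sum>z\<in>verts G. if z \<in> ?O then 0 else real k)"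
    using fin by (subst sum.cong[OF refl, of _ _ "\<lambda>z. if z \<in> ?O then 0 else real k"])
      (auto simp: w_def intro!: sum_mono2 split: if_splits)
  also have "(\<Sum>z\<in>verts G. if z \<in> ?O then 0 else real k) = (\<Sum>z\<in>verts G - ?O. real k)"
    using fin by (intro sum.mono_neutral_cong_right) auto
  also have "\<dots> = real k * (real n - real (card ?O))"
    using fin O cO n by (simp add: card_Diff_subset finite_subset of_nat_diff)
  also have "real n + \<dots> = real k * real n + (1 - real k * real (card ?O) / real n) * real n"
    using n0 by (simp add: field_simps)
  finally have sum: "(\<Sum>z\<in>verts G. real (w z))
    \<le> real k * real n + (1 - real k * real (card ?O) / real n) * real n" by simp
  have "real k * real (card ?O) / real n \<le> real k"
    using cO n0 by (simp add: divide_le_eq mult_left_mono)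
  then have "real (card (role_copies G v i)) * (real n * real k ^ (k - 1))
    \<le> dens * ((real k * real n) ^ k * exp (1 - real k * real (card ?O) / real n))"
    using card_copies_le_dens[OF G _ prod, of "role_copies G v i"] n0
    by (intro order_trans[OF card_copies_le_dens[OF G _ prod]] mult_left_mono dens_nonneg
        weight_power_le_exp[OF _ _ _ sum]) (auto simp: role_copies_def intro: sum_nonneg)
  also have "(real k * real n) ^ k = (real k * real n ^ (k - 1)) * (real n * real k ^ (k - 1))"
  proof -
    have "z ^ k = z * z ^ (k - 1)" for z :: real using k_pos by (simp flip: power_Suc)
    then show ?thesis by (simp add: power_mult_distrib)
  qed
  finally have "real (card (role_copies G v i)) * (real n * real k ^ (k - 1))
    \<le> (dens * real k * real n ^ (k - 1) * exp (1 - real k * real (card ?O) / real n))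
      * (real n * real k ^ (k - 1))" by (simp add: mult_ac)
  then show ?thesis using n0 k_pos by (subst (asm) mult_le_cancel_right_pos) auto
qed

text \<open>Weight \<open>n\<close> at \<open>x\<close> and \<open>y\<close> compensates for their
  being prescribed, and tripling on \<open>Y\<close> multiplies each product by at least
  \<open>3 ^ m\<close>. The total weight grows by at most \<open>2 * n + 2 * k * card Y\<close>,
  hence the exponent.\<close>

lemma card_pinned_copies_le:
  fixes G :: "(nat, nat set) cgraph"
  assumes G: "colored_complete T G" and n: "card (verts G) = n"
    and xy: "x \<in> verts G" "y \<in> verts G" "x \<noteq> y" and Y: "Y \<subseteq> verts G"
    and \<S>: "\<S> \<subseteq> copy_sets R G"
      "\<And>S. S \<in> \<S> \<Longrightarrow> x \<in> S \<and> y \<in> S \<and> m \<le> card ((S - {x, y}) \<inter> Y)"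
  shows "real (card \<S>) * 3 ^ m
    \<le> dens * real k ^ 2 * real n ^ (k - 2) * exp (2 + 2 * (real k * real (card Y) / real n))"
proof -
  define w where "w = (\<lambda>z. if z = x \<or> z = y then n else if z \<in> Y then 3 * k else k)"
  define t where "t = 2 + 2 * (real k * real (card Y) / real n)"
  have fin: "finite (verts G)" using G by (simp add: colored_complete_def)
  have n0: "0 < n" using xy n fin by (auto simp: card_gt_0_iff)
  have prod: "real n ^ 2 * real k ^ (k - 2) * 3 ^ m \<le> (\<Prod>z\<in>S. real (w z))" if S: "S \<in> \<S>" for S
  proof -
    have SC: "finite S" "card S = k" "x \<in> S" "y \<in> S"
      using S \<S> copy_setsD[of S R G] card_verts_R by auto
    have "(\<Prod>z\<in>S. real (w z)) = (\<Prod>z\<in>{x, y}. real (w z)) * (\<Prod>z\<in>S - {x, y}. real (w z))"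
      using SC by (subst prod.subset_diff[of "{x, y}"]) auto
    also have "(\<Prod>z\<in>{x, y}. real (w z)) = real n ^ 2"
      using xy(3) by (simp add: w_def power2_eq_square)
    also have "(\<Prod>z\<in>S - {x, y}. real (w z)) = (\<Prod>z\<in>S - {x, y}. real k * (if z \<in> Y then 3 else 1))"
      by (intro prod.cong) (auto simp: w_def)
    also have "\<dots> = real k ^ (k - 2) * 3 ^ card ((S - {x, y}) \<inter> Y)"
      using SC xy(3) by (simp add: prod.distrib card_Diff_subset numeral_2_eq_2 flip: prod.inter_restrict)
    finally have "(\<Prod>z\<in>S. real (w z))
      = real n ^ 2 * (real k ^ (k - 2) * 3 ^ card ((S - {x, y}) \<inter> Y))" .
    moreover have "(3::real) ^ m \<le> 3 ^ card ((S - {x, y}) \<inter> Y)"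
      using \<S>(2)[OF S] by (intro power_increasing) auto
    ultimately show ?thesis by (simp add: mult.assoc mult_left_mono)
  qed
  have "(\<Sum>z\<in>verts G. real (w z))
    \<le> (\<Sum>z\<in>verts G. (if z = x then real n else 0) + (if z = y then real n else 0)
        + (real k + (if z \<in> Y then 2 * real k else 0)))"
    by (intro sum_mono) (auto simp: w_def)
  also have "\<dots> = real k * real n + t * real n"
    using fin xy n n0 Y
    by (simp add: sum.distrib t_def field_simps Int_absorb1 flip: sum.inter_restrict)
  finally have sum: "(\<Sum>z\<in>verts G. real (w z)) \<le> real k * real n + t * real n" .
  have "- real k \<le> 0" "0 \<le> t" by (auto simp: t_def)
  then have t: "- real k \<le> t" by linarith
  have "real (card \<S>) * (real n ^ 2 * real k ^ (k - 2) * 3 ^ m)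
    \<le> dens * ((real k * real n) ^ k * exp t)"
    using n0 \<S>(1) t
    by (intro order_trans[OF card_copies_le_dens[OF G _ prod]] mult_left_mono dens_nonneg
        weight_power_le_exp[OF _ _ _ sum]) (auto intro: sum_nonneg)
  also have "(real k * real n) ^ k = (real k ^ 2 * real n ^ (k - 2)) * (real n ^ 2 * real k ^ (k - 2))"
  proof -
    have "z ^ k = z ^ 2 * z ^ (k - 2)" for z :: real
      using power_add[of z 2 "k - 2"] k2 by (simp only: le_add_diff_inverse)
    then show ?thesis by (simp add: power_mult_distrib)
  qed
  finally have "(real (card \<S>) * 3 ^ m) * (real n ^ 2 * real k ^ (k - 2))
    \<le> (dens * real k ^ 2 * real n ^ (k - 2) * exp t) * (real n ^ 2 * real k ^ (k - 2))"
    by (simp add: mult_ac)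
  then show ?thesis unfolding t_def[symmetric] using n0 k_pos by (subst (asm) mult_le_cancel_right_pos) auto
qed

text \<open>If \<open>x\<close> can play the role \<open>j\<close>, then the neighbors of \<open>x\<close> in a copy where it plays another
  role \<open>i\<close> are confined to the small set of excluded vertices. Tripling the weight of this set
  costs a power of \<open>k\<close> but gains \<open>3 ^ (d - 2)\<close>.\<close>

lemma card_wrong_role_copies_le:
  assumes G: "colored_complete T G" and n: "card (verts G) = n"
    and xy: "x \<in> verts G" "y \<in> verts G" "x \<noteq> y" and ij: "i \<noteq> j"
    and small: "exp (real k * real (card (excluded G x j)) / real n) \<le> 2 * exp 1 * real k"
  shows "real (card {S \<in> role_copies G x i. y \<in> S}) * (4 * real k ^ 3) \<le> dens * real n ^ (k - 2)"
proof -
  let ?\<S> = "{S \<in> role_copies G x i. y \<in> S}" and ?Y = "excluded G x j"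
  \<comment> \<open>Two neighbors of the role \<open>i\<close> may escape: the role
    \<open>j\<close>, whose edge color contains \<open>j\<close>, and the role of the prescribed
    vertex \<open>y\<close>.\<close>
  have many: "d - 2 \<le> card ((S - {x, y}) \<inter> ?Y)" if S: "S \<in> ?\<S>" for S
  proof -
    obtain f where f: "embeds G S f" "f x = i" "x \<in> S" and SV: "S \<subseteq> verts G"
      using S copy_setsD(1)[of S R G] by (auto simp: role_copies_def)
    have bij: "bij_betw f S {1..k}" and finS: "finite S" using embedsD[OF f(1)] by auto
    have i: "i \<in> {1..k}" using bij f by (auto simp: bij_betw_def)
    have "nbrs i - {j} - {f y} \<subseteq> f ` ((S - {x, y}) \<inter> ?Y)"
    proof
      fix l assume l: "l \<in> nbrs i - {j} - {f y}"
      then have "l \<in> f ` S" using nbrs_subset[of i] bij by (auto simp: bij_betw_def)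
      then obtain z where z: "z \<in> S" "f z = l" by auto
      have il: "{i, l} \<in> E" "l \<noteq> i" using l edgeD[of i l] by (auto simp: nbrs_def)
      then have zx: "z \<noteq> x" "z \<noteq> y" using l z f by auto
      then have "color G {x, z} = {i, l}"
        using embedsD(4)[OF f(1,3) z(1)] il z f by (simp add: rcol_def)
      then have "z \<in> ?Y" using z zx l ij SV by (auto simp: excluded_def)
      then show "l \<in> f ` ((S - {x, y}) \<inter> ?Y)" using z zx by blast
    qed
    then have "card (nbrs i - {j} - {f y}) \<le> card (f ` ((S - {x, y}) \<inter> ?Y))"
      using finS by (intro card_mono) auto
    also have "\<dots> \<le> card ((S - {x, y}) \<inter> ?Y)" using finS by (intro card_image_le) auto
    finally have "card (nbrs i - {j} - {f y}) \<le> card ((S - {x, y}) \<inter> ?Y)" .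
    moreover have "card (nbrs i) - 1 - 1 \<le> card (nbrs i - {j} - {f y})"
      using diff_card_le_card_Diff[of "{j}" "nbrs i"] diff_card_le_card_Diff[of "{f y}" "nbrs i - {j}"]
      by simp
    ultimately show ?thesis using card_nbrs[OF i] by linarith
  qed
  have "real (card ?\<S>) * 3 ^ (d - 2)
    \<le> dens * real k ^ 2 * real n ^ (k - 2) * exp (2 + 2 * (real k * real (card ?Y) / real n))"
    using many by (intro card_pinned_copies_le[OF G n xy]) (auto simp: role_copies_def excluded_def)
  also have "\<dots> \<le> dens * real k ^ 2 * real n ^ (k - 2) * (exp 4 * (4 * real k ^ 2))"
  proof (intro mult_left_mono)
    have "exp (2 + 2 * (real k * real (card ?Y) / real n))
        = exp 2 * exp (real k * real (card ?Y) / real n) ^ 2"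
      by (simp only: exp_add exp_double)
    also have "\<dots> \<le> exp 2 * (2 * exp 1 * real k) ^ 2"
      by (intro mult_left_mono power_mono small) auto
    also have "\<dots> = exp 2 * exp 1 ^ 2 * (4 * real k ^ 2)" by (simp add: power_mult_distrib)
    also have "exp 2 * exp 1 ^ 2 = exp (4::real)" 
      using exp_double[of "1::real"] exp_add[of 2 "2::real"] by simp
    finally show "exp (2 + 2 * (real k * real (card ?Y) / real n)) \<le> exp 4 * (4 * real k ^ 2)" .
  qed (use dens_nonneg in auto)
  finally have "real (card ?\<S>) * 3 ^ (d - 2) \<le> dens * real n ^ (k - 2) * (4 * exp 4 * real k ^ 4)"
    by (simp add: mult_ac power2_eq_square power4_eq_xxxx)
  \<comment> \<open>Here \<open>36 = 9 * 4\<close>: the \<open>9\<close> completes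
    \<open>3 ^ (d - 2)\<close> to \<open>3 ^ d\<close>, and \<open>4 * k ^ 3\<close> is the saving
    to be shown. The resulting constant \<open>144 * exp 4\<close> is at most
    \<open>144 * 81 = 11664\<close>.\<close>
  then have "(real (card ?\<S>) * 3 ^ (d - 2)) * (36 * real k ^ 3)
    \<le> (dens * real n ^ (k - 2) * (4 * exp 4 * real k ^ 4)) * (36 * real k ^ 3)"
    by (rule mult_right_mono) simp
  also have "\<dots> = dens * real n ^ (k - 2) * (144 * exp 4 * real k ^ 7)"
    by (simp add: mult_ac flip: power_add)
  also have "\<dots> \<le> dens * real n ^ (k - 2) * 3 ^ d"
  proof (intro mult_left_mono)
    have "exp (4::real) = exp 1 ^ 4" using exp_of_nat_mult[of 4 "1::real"] by simp
    also have "\<dots> \<le> 3 ^ 4" by (intro power_mono exp_le) auto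
    finally have "144 * exp (4::real) \<le> 12000" by simp
    then have "144 * exp 4 * real k ^ 7 \<le> 12000 * real k ^ 7" by (rule mult_right_mono) simp
    then show "144 * exp 4 * real k ^ 7 \<le> 3 ^ d" using degree_large by linarith
  qed (use dens_nonneg in auto)
  also have "(3::real) ^ d = 9 * 3 ^ (d - 2)"
    using power_add[of "3::real" 2 "d - 2"] d_ge by (simp only: le_add_diff_inverse) simp
  finally show ?thesis by (simp add: mult_ac)
qed

section \<open>Structure of extremal graphs\<close>

text \<open>Composing \<open>\<nu>\<close> with the inverse of \<open>f\<close> gives a labeling of
  \<open>R\<close> to which \<open>rigid_labeling\<close> applies; degrees of at least
  \<open>2\<close> supply the second edge. So a copy without wrongly colored pairs between parts is
  a transversal in the assigned roles or lies in one part.\<close>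

lemma rigid_copy:
  assumes f: "embeds G S f"
    and right: "\<And>x y. x \<in> S \<Longrightarrow> y \<in> S \<Longrightarrow> \<nu> x \<noteq> \<nu> y \<Longrightarrow> color G {x, y} = rcol E {\<nu> x, \<nu> y}"
  shows "(\<forall>x\<in>S. \<nu> x = f x) \<or> (\<exists>c. \<forall>x\<in>S. \<nu> x = c)"
proof -
  note bij = embedsD(1)[OF f]
  define g where "g = inv_into S f"
  have g: "g a \<in> S" "f (g a) = a" if "a \<in> {1..k}" for a
    using that bij by (auto simp: g_def bij_betw_def f_inv_into_f inv_into_into)
  have gf: "g (f x) = x" "f x \<in> {1..k}" if "x \<in> S" for x
    using that bij by (auto simp: g_def bij_betw_def)
  have "\<exists>c. c \<noteq> a \<and> {b, c} \<in> E" if ab: "{a, b} \<in> E" for a b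
  proof -
    have "2 \<le> card (nbrs b)" using card_nbrs[of b] d_ge edgeD[OF ab] by linarith
    then have "\<not> nbrs b \<subseteq> {a}" using card_mono[of "{a}" "nbrs b"] by auto
    then show ?thesis by (auto simp: nbrs_def)
  qed
  moreover have "rcol E {a, b} = rcol E {\<nu> (g a), \<nu> (g b)}"
    if "a \<in> {1..k}" "b \<in> {1..k}" "a \<noteq> b" "\<nu> (g a) \<noteq> \<nu> (g b)" for a b
  proof -
    have "g a \<noteq> g b" using g(2)[OF that(1)] g(2)[OF that(2)] that(3) by auto
    then show ?thesis
      using right[OF g(1) g(1), OF that(1,2,4)] embedsD(4)[OF f g(1) g(1), OF that(1,2)]
      by (simp only: g(2) that simp_thms)
  qed
  ultimately have "(\<forall>a\<in>{1..k}. \<nu> (g a) = a) \<or> (\<exists>c. \<forall>a\<in>{1..k}. \<nu> (g a) = c)"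
    by (intro rigid_labeling[OF connected edges]) auto
  then show ?thesis using gf by metis
qed

text \<open>By double counting, vertices lie in at least \<open>q\<close> copies on average, so some
  \<open>u\<close> attains \<open>q\<close>. Symmetrization transfers this to \<open>v\<close> up to
  the copies through both, at most \<open>9 * dens * k ^ 2 * n ^ (k - 2)\<close>; by
  \<open>36 * k <= n\<close> this is at most a third of \<open>q\<close>.\<close>

lemma extremal_degree_ge:
  fixes G :: "(nat, nat set) cgraph"
  assumes G: "colored_complete T G" and n: "card (verts G) = n"
    and ext: "copies R G = max_copies T R n" and dens: "0 < dens"
    and many: "3 / 4 * dens * real n ^ k \<le> real (copies R G)" and nk: "36 * k \<le> n"
    and v: "v \<in> verts G"
  shows "dens * real k * real n ^ (k - 1) / 2 \<le> real (card {S \<in> copy_sets R G. v \<in> S})"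
proof -
  let ?C = "copy_sets R G"
  define c where "c = (\<lambda>u. card {S \<in> ?C. u \<in> S})"
  have fin: "finite (verts G)" "finite ?C" using G by (auto simp: colored_complete_def finite_copy_sets)
  have n0: "0 < n" using nk k2 by linarith
  have npow: "real n ^ k = real n * real n ^ (k - 1)" "real n ^ (k - 1) = real n * real n ^ (k - 2)"
    using k2 power_Suc[of "real n" "k - 1"] power_Suc[of "real n" "k - 2"] by (auto simp: Suc_diff_Suc numeral_2_eq_2)
  have "(\<Sum>u\<in>verts G. c u) = (\<Sum>S\<in>?C. card {u \<in> verts G. u \<in> S})"
    unfolding c_def using fin by (intro sum_multicount_gen) auto
  also have "\<dots> = (\<Sum>S\<in>?C. k)"
  proof (rule sum.cong[OF refl])
    fix S assume "S \<in> ?C"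
    then have "{u \<in> verts G. u \<in> S} = S" "card S = k"
      using copy_setsD[of S R G] card_verts_R by auto
    then show "card {u \<in> verts G. u \<in> S} = k" by simp
  qed
  finally have total: "(\<Sum>u\<in>verts G. real (c u)) = real k * real (copies R G)"
    by (simp add: copies_eq_card flip: of_nat_sum)
  define q where "q = 3 / 4 * dens * real k * real n ^ (k - 1)"
  have "\<exists>u\<in>verts G. q \<le> real (c u)"
  proof (rule ccontr)
    assume "\<not> ?thesis"
    then have "(\<Sum>u\<in>verts G. real (c u)) < (\<Sum>u\<in>verts G. q)"
      using fin v by (intro sum_strict_mono) auto
    also have "\<dots> = real k * (3 / 4 * dens * real n ^ k)" by (simp add: n q_def npow(1))
    also have "\<dots> \<le> real k * real (copies R G)" using many by (intro mult_left_mono) auto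
    finally show False using total by simp
  qed
  then obtain u where u: "u \<in> verts G" "q \<le> real (c u)" by auto
  show ?thesis
  proof (cases "u = v")
    case True
    have "dens * real k * real n ^ (k - 1) / 2 \<le> q" using dens by (simp add: q_def)
    then show ?thesis using u True by (simp add: c_def)
  next
    case False
    have "real (card {S \<in> ?C. u \<in> S \<and> v \<in> S}) * 3 ^ 0
      \<le> dens * real k ^ 2 * real n ^ (k - 2) * exp (2 + 2 * (real k * real (card ({} :: nat set)) / real n))"
      using u v False by (intro card_pinned_copies_le[OF G n, of u v]) auto
    also have "\<dots> \<le> dens * real k ^ 2 * real n ^ (k - 2) * 9"
    proof (intro mult_left_mono)
      have "exp (2::real) = exp 1 ^ 2" using exp_double[of "1::real"] by simp
      also have "\<dots> \<le> 3 ^ 2" by (intro power_mono exp_le) auto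
      finally show "exp (2 + 2 * (real k * real (card ({} :: nat set)) / real n)) \<le> 9" by simp
    qed (use dens in auto)
    also have "\<dots> = (dens * real k * real n ^ (k - 2)) * (9 * real k)" by (simp add: power2_eq_square)
    also have "\<dots> \<le> (dens * real k * real n ^ (k - 2)) * (real n / 4)"
      using nk dens by (intro mult_left_mono) auto
    finally have "real (card {S \<in> ?C. u \<in> S \<and> v \<in> S}) \<le> dens * real k * real n ^ (k - 1) / 4"
      unfolding npow(2) by (simp add: mult_ac)
    moreover have "c u \<le> c v + card {S \<in> ?C. u \<in> S \<and> v \<in> S}"
      using extremal_degree_le[OF G, of R u v] ext n u v False by (simp add: c_def)
    then have "real (c u) \<le> real (c v) + real (card {S \<in> ?C. u \<in> S \<and> v \<in> S})" by linarith
    ultimately show ?thesis using u(2) by (simp add: q_def c_def)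
  qed
qed

text \<open>Each vertex is assigned a role with few excluded vertices. Copies with all vertices in
  their assigned roles are transversals free of wrong pairs, copies inside parts are counted
  separately, and the others are charged to the transversals with wrong pairs, so the product
  absorbs them.\<close>

lemma extremal_partition:
  fixes G :: "(nat, nat set) cgraph"
  assumes G: "colored_complete T G" and n: "card (verts G) = n"
    and ext: "copies R G = max_copies T R n" and dens: "0 < dens"
    and many: "3 / 4 * dens * real n ^ k \<le> real (copies R G)" and nk: "36 * k \<le> n"
  obtains \<nu> where "\<And>v. v \<in> verts G \<Longrightarrow> \<nu> v \<in> {1..k}"
    "real (copies R G) \<le> (\<Prod>i\<in>{1..k}. real (card {v \<in> verts G. \<nu> v = i}))
       + (\<Sum>i\<in>{1..k}. real (copies R (induced G {v \<in> verts G. \<nu> v = i})))"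
    "dens * real n ^ k / 2 \<le> (\<Prod>i\<in>{1..k}. real (card {v \<in> verts G. \<nu> v = i}))"
proof -
  let ?C = "copy_sets R G" and ?V = "verts G"
  have fin: "finite ?V" "finite ?C" using G by (auto simp: colored_complete_def finite_copy_sets)
  have n0: "0 < n" using nk k2 by linarith
  have npow: "real n ^ k = real n ^ 2 * real n ^ (k - 2)"
    using power_add[of "real n" 2 "k - 2"] k2 by (simp only: le_add_diff_inverse)
  have finrole: "finite (role_copies G v i)" for v i
    using fin by (auto simp: role_copies_def)
  \<comment> \<open>One of the \<open>k\<close> roles of \<open>v\<close> has at least the average
    share of its copies; comparison with \<open>card_role_copies_le\<close> leaves at most
    \<open>n / k * ln (2 * exp 1 * k)\<close> excluded vertices for it.\<close>
  have "\<exists>i\<in>{1..k}. exp (real k * real (card (excluded G v i)) / real n) \<le> 2 * exp 1 * real k"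
    if v: "v \<in> ?V" for v
  proof -
    define q where "q = dens * real n ^ (k - 1) / 2"
    have "\<exists>i\<in>{1..k}. q \<le> real (card (role_copies G v i))"
    proof (rule ccontr)
      assume none: "\<not> ?thesis"
      have "{S \<in> ?C. v \<in> S} \<subseteq> (\<Union>i\<in>{1..k}. role_copies G v i)"
      proof
        fix S assume S: "S \<in> {S \<in> ?C. v \<in> S}"
        then obtain f where f: "embeds G S f" by (auto simp: copy_sets_iff)
        then have "f v \<in> {1..k}" using S embedsD(1)[OF f] by (auto simp: bij_betw_def)
        then show "S \<in> (\<Union>i\<in>{1..k}. role_copies G v i)" using S f by (auto simp: role_copies_def)
      qed
      then have "card {S \<in> ?C. v \<in> S} \<le> card (\<Union>i\<in>{1..k}. role_copies G v i)"
        using finrole by (intro card_mono) auto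
      also have "\<dots> \<le> (\<Sum>i\<in>{1..k}. card (role_copies G v i))" by (intro card_UN_le) simp
      finally have "real (card {S \<in> ?C. v \<in> S}) \<le> (\<Sum>i\<in>{1..k}. real (card (role_copies G v i)))"
        by (simp flip: of_nat_sum)
      also have "\<dots> < (\<Sum>i\<in>{1..k}. q)" using none k2 by (intro sum_strict_mono) (auto simp: not_le)
      also have "\<dots> = dens * real k * real n ^ (k - 1) / 2" by (simp add: q_def)
      finally show False using extremal_degree_ge[OF G n ext dens many nk v] by simp
    qed
    then obtain i where i: "i \<in> {1..k}" "q \<le> real (card (role_copies G v i))" by auto
    define \<theta> where "\<theta> = real k * real (card (excluded G v i)) / real n"
    have "q \<le> dens * real k * real n ^ (k - 1) * exp (1 - \<theta>)"
      using i card_role_copies_le[OF G v n, of i] by (simp add: \<theta>_def)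
    then have "(dens * real n ^ (k - 1)) * (1 / 2) \<le> (dens * real n ^ (k - 1)) * (real k * exp (1 - \<theta>))"
      by (simp add: q_def mult_ac)
    then have "1 / 2 \<le> real k * exp (1 - \<theta>)"
      using dens n0 by (subst (asm) mult_le_cancel_left_pos) auto
    then have "exp \<theta> \<le> 2 * exp 1 * real k" by (simp add: exp_diff field_simps)
    then show ?thesis using i by (auto simp: \<theta>_def)
  qed
  then obtain \<nu> where \<nu>: "\<And>v. v \<in> ?V \<Longrightarrow> \<nu> v \<in> {1..k}"
    and \<nu>_exc: "\<And>v. v \<in> ?V \<Longrightarrow>
      exp (real k * real (card (excluded G v (\<nu> v))) / real n) \<le> 2 * exp 1 * real k"
    by metis
  \<comment> \<open>By \<open>card_wrong_role_copies_le\<close>, \<open>b\<close> bounds the copies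
    through \<open>x\<close> and \<open>y\<close> with \<open>x\<close> in one fixed wrong role;
    \<open>D\<close> collects these over all wrong roles. \<open>W\<close> holds both orientations
    of a wrong pair, since either end may play the wrong role.\<close>
  define b where "b = dens * real n ^ (k - 2) / (4 * real k ^ 3)"
  define V where "V = (\<lambda>i. {v \<in> ?V. \<nu> v = i})"
  define D where "D = (\<lambda>(x, y). \<Union>i\<in>{1..k} - {\<nu> x}. {S \<in> role_copies G x i. y \<in> S})"
  define W where "W = {(x, y) \<in> ?V \<times> ?V. \<nu> x \<noteq> \<nu> y \<and> color G {x, y} \<noteq> rcol E {\<nu> x, \<nu> y}}"
  define Nat where "Nat = {S \<in> ?C. \<exists>f. embeds G S f \<and> (\<forall>x\<in>S. \<nu> x = f x)}"
  define Bad where "Bad = ?C - Nat - (\<Union>i\<in>{1..k}. copy_sets R (induced G (V i)))"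
  define \<T> where "\<T> = PiE {1..k} V"
  define \<W> where "\<W> = {g \<in> \<T>. \<exists>i\<in>{1..k}. \<exists>j\<in>{1..k}. (g i, g j) \<in> W}"
  have b0: "0 \<le> b" using dens by (simp add: b_def)
  have finV: "finite (V i)" for i using fin by (simp add: V_def)
  have fin\<T>: "finite \<T>" unfolding \<T>_def using finV by (intro finite_PiE) auto
  have finW: "finite W" using fin by (auto simp: W_def intro: finite_subset[of _ "?V \<times> ?V"])
  have g\<nu>: "g i \<in> ?V" "\<nu> (g i) = i" if "g \<in> \<T>" "i \<in> {1..k}" for g i
    using that by (auto simp: \<T>_def V_def)
  have D_le: "real (card (D (x, y))) \<le> real k * b" if "x \<in> ?V" "y \<in> ?V" "x \<noteq> y" for x y
  proof -
    have "real (card (D (x, y))) \<le> real (card ({1..k} - {\<nu> x})) * b"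
      unfolding D_def prod.case
    proof (rule card_UN_le_real)
      fix i assume "i \<in> {1..k} - {\<nu> x}"
      then have "real (card {S \<in> role_copies G x i. y \<in> S}) * (4 * real k ^ 3) \<le> dens * real n ^ (k - 2)"
        using \<nu>_exc[of x] that by (intro card_wrong_role_copies_le[OF G n that]) auto
      then show "real (card {S \<in> role_copies G x i. y \<in> S}) \<le> b"
        using k_pos by (simp add: b_def field_simps)
    qed simp
    also have "real (card ({1..k} - {\<nu> x})) * b \<le> real k * b"
      using b0 card_mono[of "{1..k}" "{1..k} - {\<nu> x}"] by (intro mult_right_mono) auto
    finally show ?thesis .
  qed
  have finD: "finite (D p)" for p using finrole by (auto simp: D_def split: prod.splits)

  \<comment> \<open>A crude count: a copy with a vertex in a wrong role is charged to that vertex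
    and an arbitrary second one. All pairs together contribute at most a quarter of
    \<open>dens * n ^ k\<close>, so \<open>Nat\<close> keeps half of it.\<close>
  have "?C - Nat \<subseteq> (\<Union>p\<in>{(x, y) \<in> ?V \<times> ?V. x \<noteq> y}. D p)"
  proof
    fix S assume S: "S \<in> ?C - Nat"
    then obtain f where f: "embeds G S f" and SV: "S \<subseteq> ?V" by (auto simp: copy_sets_iff)
    then obtain x where x: "x \<in> S" "\<nu> x \<noteq> f x" using S by (auto simp: Nat_def)
    have "\<not> S \<subseteq> {x}" using embedsD(2,3)[OF f] k2 card_mono[of "{x}" S] by auto
    then obtain y where y: "y \<in> S" "x \<noteq> y" by auto
    have "f x \<in> {1..k}" using x embedsD(1)[OF f] by (auto simp: bij_betw_def)
    then have "S \<in> D (x, y)" using S f x y by (auto simp: D_def role_copies_def)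
    then show "S \<in> (\<Union>p\<in>{(x, y) \<in> ?V \<times> ?V. x \<noteq> y}. D p)" using x y SV by blast
  qed
  then have "card (?C - Nat) \<le> card (\<Union>p\<in>{(x, y) \<in> ?V \<times> ?V. x \<noteq> y}. D p)"
    using fin finD by (intro card_mono finite_UN_I) (auto intro: finite_subset[of _ "?V \<times> ?V"])
  then have "real (card (?C - Nat)) \<le> real (card (\<Union>p\<in>{(x, y) \<in> ?V \<times> ?V. x \<noteq> y}. D p))" by simp
  also have "\<dots> \<le> real (card {(x, y) \<in> ?V \<times> ?V. x \<noteq> y}) * (real k * b)"
    using fin D_le by (intro card_UN_le_real) (auto intro: finite_subset[of _ "?V \<times> ?V"])
  also have "\<dots> \<le> real (card (?V \<times> ?V)) * (real k * b)"
    using fin b0 by (intro mult_right_mono of_nat_mono card_mono) auto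
  also have "\<dots> = dens * real n ^ k * (1 / (4 * real k ^ 2))"
    using k_pos n by (simp add: b_def card_cartesian_product npow field_simps power2_eq_square power3_eq_cube)
  also have "\<dots> \<le> dens * real n ^ k * (1 / 4)"
    using k_pos dens by (intro mult_left_mono) (auto simp: field_simps)
  finally have "real (card (?C - Nat)) \<le> dens * real n ^ k / 4" by simp
  moreover have "card ?C = card Nat + card (?C - Nat)"
    using fin by (subst card_Un_disjoint[symmetric]) (auto simp: Nat_def intro!: arg_cong[where f = card])
  ultimately have Nat_ge: "dens * real n ^ k / 2 \<le> real (card Nat)"
    using many by (simp add: copies_eq_card)

  have inj: "inj_on (\<lambda>g. g ` {1..k}) \<T>"
  proof (rule inj_onI)
    fix g h assume gh: "g \<in> \<T>" "h \<in> \<T>" "g ` {1..k} = h ` {1..k}"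
    have "g i = h i" if i: "i \<in> {1..k}" for i
    proof -
      obtain j where j: "j \<in> {1..k}" "g i = h j" using gh(3) i by (metis imageE imageI)
      then show ?thesis using g\<nu>[OF gh(1) i] g\<nu>[OF gh(2) j(1)] by simp
    qed
    then show "g = h" using gh by (auto simp: \<T>_def intro: PiE_ext)
  qed
  have "Nat \<subseteq> (\<lambda>g. g ` {1..k}) ` (\<T> - \<W>)"
  proof
    fix S assume "S \<in> Nat"
    then obtain f where f: "embeds G S f" and f\<nu>: "\<And>x. x \<in> S \<Longrightarrow> \<nu> x = f x" and SV: "S \<subseteq> ?V"
      by (auto simp: Nat_def copy_sets_iff)
    note bij = embedsD(1)[OF f]
    define g where "g = restrict (inv_into S f) {1..k}"
    have g: "g i \<in> S" "f (g i) = i" if "i \<in> {1..k}" for i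
      using that bij by (auto simp: g_def bij_betw_def f_inv_into_f inv_into_into)
    then have g\<T>: "g \<in> \<T>" using SV f\<nu> by (auto simp: \<T>_def V_def g_def PiE_def)
    have "(g i, g j) \<notin> W" if ij: "i \<in> {1..k}" "j \<in> {1..k}" for i j
    proof
      assume w: "(g i, g j) \<in> W"
      then have "g i \<noteq> g j" by (auto simp: W_def)
      then show False using w embedsD(4)[OF f] g ij f\<nu> by (auto simp: W_def)
    qed
    then have "g \<in> \<T> - \<W>" using g\<T> by (auto simp: \<W>_def)
    moreover have "g ` {1..k} = S"
      using bij bij_betw_inv_into[OF bij] by (auto simp: g_def bij_betw_def)
    ultimately show "S \<in> (\<lambda>g. g ` {1..k}) ` (\<T> - \<W>)" by blast
  qed
  then have "card Nat \<le> card ((\<lambda>g. g ` {1..k}) ` (\<T> - \<W>))"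
    using fin\<T> by (intro card_mono) auto
  also have "\<dots> = card (\<T> - \<W>)" using inj by (intro card_image) (auto intro: inj_on_subset)
  also have "\<dots> = card \<T> - card \<W>"
    using fin\<T> by (intro card_Diff_subset) (auto simp: \<W>_def intro: finite_subset)
  finally have "card Nat \<le> card \<T> - card \<W>" .
  moreover have "card \<W> \<le> card \<T>" using fin\<T> by (intro card_mono) (auto simp: \<W>_def)
  ultimately have Nat_le: "real (card Nat) + real (card \<W>) \<le> real (card \<T>)" by linarith
  have card\<T>: "real (card \<T>) = (\<Prod>i\<in>{1..k}. real (card (V i)))"
    by (simp add: \<T>_def card_PiE)

  \<comment> \<open>Shrinking two parts to \<open>{x}\<close> and \<open>{y}\<close> divides the
    number of transversals by at most \<open>n ^ 2\<close>, and there are at least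
    \<open>card Nat\<close> transversals.\<close>
  have wrong: "(x, y) \<in> W \<Longrightarrow> dens * real n ^ (k - 2) / 2
      \<le> real (card {g \<in> \<T>. g (\<nu> x) = x \<and> g (\<nu> y) = y})" for x y
  proof -
    assume xy: "(x, y) \<in> W"
    then have xyV: "x \<in> ?V" "y \<in> ?V" "\<nu> x \<noteq> \<nu> y" by (auto simp: W_def)
    define V' where "V' = (\<lambda>i. if i = \<nu> x then {x} else if i = \<nu> y then {y} else V i)"
    have "PiE {1..k} V' \<subseteq> {g \<in> \<T>. g (\<nu> x) = x \<and> g (\<nu> y) = y}"
    proof
      fix g assume g: "g \<in> PiE {1..k} V'"
      have "V' i \<subseteq> V i" for i using xyV by (auto simp: V'_def V_def)
      then have "g \<in> \<T>" using g by (auto simp: \<T>_def PiE_def Pi_def)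
      moreover have "g (\<nu> x) \<in> V' (\<nu> x)" "g (\<nu> y) \<in> V' (\<nu> y)"
        using g \<nu> xyV by (auto simp: PiE_def Pi_def)
      ultimately show "g \<in> {g \<in> \<T>. g (\<nu> x) = x \<and> g (\<nu> y) = y}" using xyV(3) by (auto simp: V'_def)
    qed
    then have "card (PiE {1..k} V') \<le> card {g \<in> \<T>. g (\<nu> x) = x \<and> g (\<nu> y) = y}"
      using fin\<T> by (intro card_mono) auto
    then have le: "(\<Prod>i\<in>{1..k}. real (card (V' i))) \<le> real (card {g \<in> \<T>. g (\<nu> x) = x \<and> g (\<nu> y) = y})"
      by (simp add: card_PiE flip: of_nat_prod)
    have "real (card \<T>) \<le> (\<Prod>i\<in>{1..k}. real (card (V' i)) *
        ((if i = \<nu> x then real n else 1) * (if i = \<nu> y then real n else 1)))"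
      unfolding card\<T>
    proof (intro prod_mono conjI)
      fix i
      have "card (V i) \<le> n" using card_mono[OF fin(1), of "V i"] n by (auto simp: V_def)
      then show "real (card (V i)) \<le> real (card (V' i)) *
          ((if i = \<nu> x then real n else 1) * (if i = \<nu> y then real n else 1))"
        using xyV by (auto simp: V'_def)
    qed simp
    also have "\<dots> = (\<Prod>i\<in>{1..k}. real (card (V' i))) * (real n * real n)"
      using \<nu>[OF xyV(1)] \<nu>[OF xyV(2)] by (simp add: prod.distrib prod.delta)
    also have "\<dots> \<le> real (card {g \<in> \<T>. g (\<nu> x) = x \<and> g (\<nu> y) = y}) * (real n * real n)"
      using le by (intro mult_right_mono) auto
    finally have "dens * real n ^ k / 2
        \<le> real (card {g \<in> \<T>. g (\<nu> x) = x \<and> g (\<nu> y) = y}) * (real n * real n)"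
      using Nat_ge Nat_le by simp
    then have "(dens * real n ^ (k - 2) / 2) * (real n * real n)
        \<le> real (card {g \<in> \<T>. g (\<nu> x) = x \<and> g (\<nu> y) = y}) * (real n * real n)"
      by (simp add: npow power2_eq_square mult_ac)
    then show ?thesis using n0 by (subst (asm) mult_le_cancel_right_pos) auto
  qed

  \<comment> \<open>Double counting of wrong pairs against the transversals through them; a
    transversal contains at most \<open>k * k\<close> ordered pairs.\<close>
  have "real (card W) * (dens * real n ^ (k - 2) / 2)
      \<le> (\<Sum>(x, y)\<in>W. real (card {g \<in> \<T>. g (\<nu> x) = x \<and> g (\<nu> y) = y}))"
    using sum_mono[of W "\<lambda>_. dens * real n ^ (k - 2) / 2"
      "\<lambda>(x, y). real (card {g \<in> \<T>. g (\<nu> x) = x \<and> g (\<nu> y) = y})"] wrong by (auto split: prod.splits)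
  also have "\<dots> = real (\<Sum>p\<in>W. card {g \<in> \<T>. g (\<nu> (fst p)) = fst p \<and> g (\<nu> (snd p)) = snd p})"
    by (simp add: case_prod_unfold)
  also have "(\<Sum>p\<in>W. card {g \<in> \<T>. g (\<nu> (fst p)) = fst p \<and> g (\<nu> (snd p)) = snd p})
      = (\<Sum>g\<in>\<T>. card {p \<in> W. g (\<nu> (fst p)) = fst p \<and> g (\<nu> (snd p)) = snd p})"
    using finW fin\<T> by (intro sum_multicount_gen) auto
  also have "\<dots> \<le> (\<Sum>g\<in>\<T>. if g \<in> \<W> then k * k else 0)"
  proof (rule sum_mono)
    fix g assume g: "g \<in> \<T>"
    let ?P = "{p \<in> W. g (\<nu> (fst p)) = fst p \<and> g (\<nu> (snd p)) = snd p}"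
    have sub: "?P \<subseteq> (\<lambda>(i, j). (g i, g j)) ` ({1..k} \<times> {1..k})"
    proof
      fix p assume p: "p \<in> ?P"
      then have "\<nu> (fst p) \<in> {1..k}" "\<nu> (snd p) \<in> {1..k}" using \<nu> by (auto simp: W_def)
      then show "p \<in> (\<lambda>(i, j). (g i, g j)) ` ({1..k} \<times> {1..k})"
        using p by (intro image_eqI[of _ _ "(\<nu> (fst p), \<nu> (snd p))"]) auto
    qed
    show "card ?P \<le> (if g \<in> \<W> then k * k else 0)"
    proof (cases "g \<in> \<W>")
      case True
      have "card ?P \<le> card ({1..k} \<times> {1..k})"
        by (rule order_trans[OF card_mono[OF _ sub] card_image_le]) auto
      then show ?thesis using True by (simp add: card_cartesian_product)
    next
      case False
      have "?P = {}"
      proof (rule ccontr)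
        assume "?P \<noteq> {}"
        then obtain p where "p \<in> ?P" by blast
        then have "p \<in> W" "p \<in> (\<lambda>(i, j). (g i, g j)) ` ({1..k} \<times> {1..k})" using sub by auto
        then show False using False g by (auto simp: \<W>_def)
      qed
      then show ?thesis by (simp only: card.empty)
    qed
  qed
  also have "\<dots> = card \<W> * (k * k)"
    using fin\<T> by (subst sum.inter_filter[symmetric]) (auto simp: \<W>_def intro!: arg_cong[where f = card])
  finally have W_le: "real (card W) * (dens * real n ^ (k - 2) / 2) \<le> real (card \<W>) * (real k * real k)"
    by simp

  \<comment> \<open>By rigidity such a copy contains a wrong pair. Its two ends cannot both play
    their assigned roles, as the color would then be right.\<close>
  have "Bad \<subseteq> (\<Union>p\<in>W. D p)"
  proof
    fix S assume S: "S \<in> Bad"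
    then obtain f where f: "embeds G S f" and SV: "S \<subseteq> ?V" by (auto simp: Bad_def copy_sets_iff)
    have S0: "S \<noteq> {}" using embedsD(3)[OF f] k_pos by auto
    have "\<exists>x\<in>S. \<exists>y\<in>S. (x, y) \<in> W"
    proof (rule ccontr)
      assume "\<not> ?thesis"
      then have "color G {x, y} = rcol E {\<nu> x, \<nu> y}" if "x \<in> S" "y \<in> S" "\<nu> x \<noteq> \<nu> y" for x y
        using that SV by (auto simp: W_def)
      from rigid_copy[OF f this] show False
      proof
        assume "\<forall>x\<in>S. \<nu> x = f x"
        then show False using S f by (auto simp: Bad_def Nat_def)
      next
        assume "\<exists>c. \<forall>x\<in>S. \<nu> x = c"
        then obtain c where c: "\<And>x. x \<in> S \<Longrightarrow> \<nu> x = c" by auto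
        have "c \<in> {1..k}" using c \<nu> SV S0 by blast
        moreover have "S \<in> copy_sets R (induced G (V c))"
          using f c SV by (auto simp: copy_sets_iff induced_def embeds_def V_def)
        ultimately show False using S by (auto simp: Bad_def)
      qed
    qed
    then obtain x y where xy: "x \<in> S" "y \<in> S" "(x, y) \<in> W" by auto
    then have ne: "x \<noteq> y" and yx: "(y, x) \<in> W" by (auto simp: W_def insert_commute)
    have "\<nu> x \<noteq> f x \<or> \<nu> y \<noteq> f y" using xy(3) embedsD(4)[OF f xy(1,2) ne] by (auto simp: W_def)
    moreover have "f x \<in> {1..k}" "f y \<in> {1..k}" using xy embedsD(1)[OF f] by (auto simp: bij_betw_def)
    ultimately have "S \<in> D (x, y) \<or> S \<in> D (y, x)"
      using S f xy(1,2) by (auto simp: D_def role_copies_def Bad_def)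
    then show "S \<in> (\<Union>p\<in>W. D p)" using xy(3) yx by blast
  qed
  then have "card Bad \<le> card (\<Union>p\<in>W. D p)"
    using finW finD by (intro card_mono finite_UN_I) auto
  then have "real (card Bad) \<le> real (card (\<Union>p\<in>W. D p))" by simp
  also have "\<dots> \<le> real (card W) * (real k * b)"
    using finW D_le by (intro card_UN_le_real) (auto simp: W_def)
  \<comment> \<open>In the denominator \<open>4 * k ^ 3\<close> of \<open>b\<close>, one factor
    \<open>k\<close> pays for the wrong roles and \<open>k ^ 2\<close> for the pairs of a
    transversal.\<close>
  also have "\<dots> = real (card W) * (dens * real n ^ (k - 2) / 2) / (2 * real k ^ 2)"
    using k_pos by (simp add: b_def field_simps power2_eq_square power3_eq_cube)
  also have "\<dots> \<le> real (card \<W>) * (real k * real k) / (2 * real k ^ 2)"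
    using W_le by (rule divide_right_mono) simp
  also have "\<dots> \<le> real (card \<W>)" using k_pos by (simp add: power2_eq_square)
  finally have Bad_le: "real (card Bad) \<le> real (card \<W>)" .

  have "?C \<subseteq> Nat \<union> Bad \<union> (\<Union>i\<in>{1..k}. copy_sets R (induced G (V i)))" by (auto simp: Bad_def)
  then have "card ?C \<le> card (Nat \<union> Bad \<union> (\<Union>i\<in>{1..k}. copy_sets R (induced G (V i))))"
    using fin finV by (intro card_mono) (auto simp: Nat_def Bad_def induced_def intro!: finite_copy_sets)
  also have "\<dots> \<le> card Nat + card Bad + card (\<Union>i\<in>{1..k}. copy_sets R (induced G (V i)))"
    by (intro order_trans[OF card_Un_le] add_mono card_Un_le order_refl)
  also have "card (\<Union>i\<in>{1..k}. copy_sets R (induced G (V i))) \<le> (\<Sum>i\<in>{1..k}. copies R (induced G (V i)))"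
    unfolding copies_eq_card by (intro card_UN_le) simp
  finally have "real (copies R G) \<le> real (card Nat) + real (card Bad)
      + (\<Sum>i\<in>{1..k}. real (copies R (induced G (V i))))"
    by (simp add: copies_eq_card flip: of_nat_sum of_nat_add)
  then have "real (copies R G) \<le> (\<Prod>i\<in>{1..k}. real (card (V i)))
      + (\<Sum>i\<in>{1..k}. real (copies R (induced G (V i))))"
    using Nat_le Bad_le card\<T> by linarith
  moreover have "dens * real n ^ k / 2 \<le> (\<Prod>i\<in>{1..k}. real (card (V i)))"
    using Nat_ge Nat_le card\<T> by linarith
  ultimately show thesis using that[of \<nu>] \<nu> by (simp add: V_def)
qed

text \<open>In an extremal graph the copies inside a part number at most \<open>dens\<close> times
  the \<open>k\<close>-th power of its size. The polynomial inequality compares what remains with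
  the product \<open>P\<close> of the sizes, and dividing by \<open>P\<close> leaves an error that
  vanishes for large \<open>n\<close>.\<close>

lemma dens_le:
  assumes dens: "0 < dens"
  shows "dens * (real k ^ k - real k) \<le> 1"
proof -
  \<comment> \<open>The ratio of the falling factorial to \<open>n ^ k\<close>; monotonicity of
    \<open>ind\<close> gives the lower bound \<open>dens * \<rho> n * n ^ k\<close> for the extremal
    count.\<close>
  define \<rho> where "\<rho> = (\<lambda>n. fact k * (real (n choose k) / real n ^ k))"
  have lim: "\<rho> \<longlonglongrightarrow> 1"
    using tendsto_mult[OF tendsto_const[of "fact k"] tendsto_choose_over_power[of k]] by (simp add: \<rho>_def)
  have "dens * (real k ^ k - real k) \<le> 1 + 2 * (1 - \<rho> n)" if \<rho>: "3 / 4 < \<rho> n" and nk: "36 * k \<le> n" for n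
  proof -
    have n0: "0 < n" "k \<le> n" using nk k2 by auto
    obtain G :: "(nat, nat set) cgraph" where G: "colored_complete T G" "card (verts G) = n"
      "copies R G = max_copies T R n" using max_copies_attained[OF T_nonempty] by blast
    have fin: "finite (verts G)" using G by (simp add: colored_complete_def)
    have "dens * \<rho> n * real n ^ k = inducibility T R * real (n choose k)"
      using n0 by (simp add: dens_def \<rho>_def)
    also have "\<dots> \<le> real (copies R G)"
      unfolding G(3) by (rule inducibility_le_max_copies[OF T_nonempty card_verts_R n0(2)])
    finally have ge: "dens * \<rho> n * real n ^ k \<le> real (copies R G)" .
    have "3 / 4 * dens * real n ^ k \<le> dens * \<rho> n * real n ^ k"
      using \<rho> dens by (intro mult_right_mono) auto
    then have many: "3 / 4 * dens * real n ^ k \<le> real (copies R G)" using ge by linarith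
    obtain \<nu> where \<nu>: "\<And>v. v \<in> verts G \<Longrightarrow> \<nu> v \<in> {1..k}"
      and le: "real (copies R G) \<le> (\<Prod>i\<in>{1..k}. real (card {v \<in> verts G. \<nu> v = i}))
       + (\<Sum>i\<in>{1..k}. real (copies R (induced G {v \<in> verts G. \<nu> v = i})))"
      and big: "dens * real n ^ k / 2 \<le> (\<Prod>i\<in>{1..k}. real (card {v \<in> verts G. \<nu> v = i}))"
      using extremal_partition[OF G dens many nk] by blast
    define s where "s = (\<lambda>i. real (card {v \<in> verts G. \<nu> v = i}))"
    define P where "P = (\<Prod>i\<in>{1..k}. s i)"
    \<comment> \<open>This turns the error \<open>dens * n ^ k * (1 - \<rho> n)\<close> into a
      multiple of \<open>P\<close>, so that \<open>P\<close> cancels.\<close>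
    have P: "dens * real n ^ k \<le> 2 * P" using big by (simp add: P_def s_def)
    have P0: "0 < P" using P dens n0 by (smt (verit) zero_less_power mult_pos_pos of_nat_0_less_iff)
    have s0: "0 < s i" if "i \<in> {1..k}" for i
    proof (rule ccontr)
      assume "\<not> 0 < s i"
      then have "s i = 0" by (simp add: s_def)
      then have "P = 0" using that by (auto simp: P_def intro!: prod_zero bexI[of _ i])
      then show False using P0 by simp
    qed
    have "n = (\<Sum>i\<in>{1..k}. card {v \<in> verts G. \<nu> v = i})"
    proof -
      have "verts G = (\<Union>i\<in>{1..k}. {v \<in> verts G. \<nu> v = i})" using \<nu> by auto
      also have "card \<dots> = (\<Sum>i\<in>{1..k}. card {v \<in> verts G. \<nu> v = i})"
        using fin by (intro card_UN_disjoint) auto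
      finally show ?thesis using G by simp
    qed
    then have sum_s: "(\<Sum>i\<in>{1..k}. s i) = real n" by (simp add: s_def flip: of_nat_sum)
    have "real (copies R (induced G {v \<in> verts G. \<nu> v = i})) \<le> dens * s i ^ k" for i
    proof -
      have "colored_complete T (induced G {v \<in> verts G. \<nu> v = i})"
        using G(1) by (auto simp: colored_complete_def induced_def nsets_def)
      then have "copies R (induced G {v \<in> verts G. \<nu> v = i}) \<le> max_copies T R (card {v \<in> verts G. \<nu> v = i})"
        by (rule copies_le_max_copies) (simp add: induced_def)
      then show ?thesis using max_copies_le_dens[of "card {v \<in> verts G. \<nu> v = i}"]
        unfolding s_def by linarith
    qed
    then have "(\<Sum>i\<in>{1..k}. real (copies R (induced G {v \<in> verts G. \<nu> v = i}))) \<le> dens * (\<Sum>i\<in>{1..k}. s i ^ k)"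
      unfolding sum_distrib_left by (intro sum_mono)
    then have rec: "dens * \<rho> n * real n ^ k \<le> P + dens * (\<Sum>i\<in>{1..k}. s i ^ k)"
      using ge le by (simp add: P_def s_def)
    have "(real k ^ k - real k) * P \<le> real n ^ k - (\<Sum>i\<in>{1..k}. s i ^ k)"
      unfolding sum_s[symmetric] P_def
      by (rule power_sum_minus_sum_powers_ge) (use s0 k_pos in auto)
    then have "dens * ((real k ^ k - real k) * P) \<le> dens * (real n ^ k - (\<Sum>i\<in>{1..k}. s i ^ k))"
      using dens by (intro mult_left_mono) auto
    also have "\<dots> \<le> P + (dens * real n ^ k) * (1 - \<rho> n)" using rec by (simp add: algebra_simps)
    also have "\<dots> \<le> P + (2 * P) * (1 - \<rho> n)"
    proof (intro add_left_mono mult_right_mono P)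
      have "real ((n choose k) * fact k) \<le> real (n ^ k)" by (simp only: of_nat_le_iff binomial_fact_pow)
      then show "0 \<le> 1 - \<rho> n" using n0 by (simp add: \<rho>_def field_simps)
    qed
    finally have "(dens * (real k ^ k - real k)) * P \<le> (1 + 2 * (1 - \<rho> n)) * P" by (simp add: algebra_simps)
    then show ?thesis using P0 by (subst (asm) mult_le_cancel_right_pos)
  qed
  moreover have "\<forall>\<^sub>F n in sequentially. 3 / 4 < \<rho> n \<and> 36 * k \<le> n"
    by (intro eventually_conj order_tendstoD(1)[OF lim] eventually_ge_at_top) simp
  ultimately have "\<forall>\<^sub>F n in sequentially. dens * (real k ^ k - real k) \<le> 1 + 2 * (1 - \<rho> n)"
    by (elim eventually_mono) blast
  moreover have "(\<lambda>n. 1 + 2 * (1 - \<rho> n)) \<longlonglongrightarrow> 1 + 2 * (1 - 1)" by (intro tendsto_intros lim)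
  ultimately show ?thesis
    using tendsto_lowerbound[of "\<lambda>n. 1 + 2 * (1 - \<rho> n)" _ sequentially] by auto
qed

text \<open>Degrees are at most \<open>k\<close>, so for \<open>k <= 3\<close> the power
  \<open>3 ^ d\<close> is too small. The blow-up estimates start at \<open>k = 4\<close>.\<close>

lemma k_ge_4: "4 \<le> k"
proof (rule ccontr)
  assume "\<not> 4 \<le> k"
  moreover have "d \<le> k"
    using card_nbrs[of 1] card_mono[OF _ nbrs_subset[of 1]] k2 by simp
  ultimately have "(3::real) ^ d \<le> 3 ^ 3" by (intro power_increasing) auto
  moreover have "1 \<le> real k ^ 7" using k2 by (intro one_le_power) auto
  ultimately show False using degree_large by simp
qed

end

section \<open>Iterated balanced blow-ups\<close>

lemma iterated_blowup_colored_complete: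
  assumes F: "colored_complete T F" and "iterated_blowup T F G"
  shows "colored_complete T G"
  using assms(2)
proof induction
  case (blowup G P)
  show ?case
    unfolding colored_complete_def
  proof (intro conjI ballI)
    fix e assume "e \<in> [verts G]\<^bsup>2\<^esup>"
    then obtain x y where e: "e = {x, y}" "x \<noteq> y" "x \<in> verts G" "y \<in> verts G"
      by (auto simp: nsets_2_eq)
    then obtain i j where ij: "i \<in> verts F" "j \<in> verts F" "x \<in> P i" "y \<in> P j"
      using blowup.hyps(3) by auto
    show "color G e \<in> T"
    proof (cases "i = j")
      case True
      then have "e \<in> [P i]\<^bsup>2\<^esup>" using e ij by simp
      then show ?thesis using blowup.IH ij(1) by (auto simp: colored_complete_def induced_def)
    next
      case False
      then have "color G e = color F {i, j}" using blowup.hyps(6) e ij by auto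
      moreover have "{i, j} \<in> [verts F]\<^bsup>2\<^esup>" using ij False by simp
      ultimately show ?thesis using F by (auto simp: colored_complete_def)
    qed
  qed (use blowup in simp)
qed

text \<open>Only colors of pairs of vertices matter. This identifies a part of a glued graph with
  the graph built on that part, whose color functions may differ on other sets.\<close>

lemma iterated_blowup_cong:
  assumes "iterated_blowup T F G" "verts G' = verts G" "\<And>e. e \<in> [verts G]\<^bsup>2\<^esup> \<Longrightarrow> color G' e = color G e"
  shows "iterated_blowup T F G'"
  using assms
proof (induction arbitrary: G')
  case (small G)
  then show ?case by (intro iterated_blowup.small) (auto simp: colored_complete_def)
next
  case (blowup G P)
  have sub: "P i \<subseteq> verts G" if "i \<in> verts F" for i using that blowup.hyps(3) by auto
  show ?case
  proof (rule iterated_blowup.blowup[where P = P])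
    show "\<forall>i\<in>verts F. iterated_blowup T F (induced G' (P i))"
    proof
      fix i assume i: "i \<in> verts F"
      have "color G' e = color G e" if "e \<in> [P i]\<^bsup>2\<^esup>" for e
        using that nsets_mono[OF sub[OF i]] blowup.prems(2) by blast
      then show "iterated_blowup T F (induced G' (P i))"
        using blowup.IH i by (auto simp: induced_def)
    qed
    show "\<forall>i\<in>verts F. \<forall>j\<in>verts F. i \<noteq> j \<longrightarrow> (\<forall>v\<in>P i. \<forall>w\<in>P j. color G' {v, w} = color F {i, j})"
    proof (intro ballI impI)
      fix i j v w assume a: "i \<in> verts F" "j \<in> verts F" "i \<noteq> j" "v \<in> P i" "w \<in> P j"
      then have "v \<noteq> w" using blowup.hyps(4) by (auto simp: disjoint_family_on_def)
      then have "{v, w} \<in> [verts G]\<^bsup>2\<^esup>" using a sub by auto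
      then show "color G' {v, w} = color F {i, j}" using blowup.prems(2) blowup.hyps(6) a by simp
    qed
  qed (use blowup in auto)
qed

text \<open>One vertex from each part forms a copy by construction. As \<open>F\<close> has at least
  two vertices, such a copy meets two parts and differs from all copies inside a part.\<close>

lemma copies_blowup_ge:
  fixes F :: "('v, 'c) cgraph" and G :: "('w, 'c) cgraph"
  assumes k: "2 \<le> card (verts F)" and fin: "finite (verts G)"
    and P: "verts G = (\<Union>i\<in>verts F. P i)" "disjoint_family_on P (verts F)"
    and col: "\<And>i j v w. i \<in> verts F \<Longrightarrow> j \<in> verts F \<Longrightarrow> i \<noteq> j \<Longrightarrow> v \<in> P i \<Longrightarrow> w \<in> P j
      \<Longrightarrow> color G {v, w} = color F {i, j}"
  shows "(\<Prod>i\<in>verts F. card (P i)) + (\<Sum>i\<in>verts F. copies F (induced G (P i))) \<le> copies F G"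
proof -
  let ?I = "verts F"
  define Tr where "Tr = (\<lambda>g. g ` ?I) ` PiE ?I P"
  define In where "In = (\<lambda>i. copy_sets F (induced G (P i)))"
  have finI: "finite ?I" using k card.infinite by fastforce
  have finP: "finite (P i)" if "i \<in> ?I" for i using that fin P by (auto intro: finite_subset)
  have same: "i = j" if "i \<in> ?I" "j \<in> ?I" "x \<in> P i" "x \<in> P j" for i j x
    using that P(2) by (auto simp: disjoint_family_on_def)
  have inj: "inj_on (\<lambda>g. g ` ?I) (PiE ?I P)"
  proof (rule inj_onI)
    fix g h assume gh: "g \<in> PiE ?I P" "h \<in> PiE ?I P" "g ` ?I = h ` ?I"
    have "g i = h i" if i: "i \<in> ?I" for i
    proof -
      obtain j where j: "j \<in> ?I" "g i = h j" using gh(3) i by (metis imageE imageI)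
      have "g i \<in> P i" "h j \<in> P j" using PiE_mem[OF gh(1) i] PiE_mem[OF gh(2) j(1)] .
      then have "i = j" using same[OF i j(1), of "g i"] j(2) by simp
      then show ?thesis using j(2) by simp
    qed
    then show "g = h" using gh by (auto intro: PiE_ext)
  qed
  have cardTr: "card Tr = (\<Prod>i\<in>?I. card (P i))"
    unfolding Tr_def using finI by (simp add: card_image[OF inj] card_PiE)
  have finTr: "finite Tr" unfolding Tr_def using finI finP by (intro finite_imageI finite_PiE) auto
  have Tr: "Tr \<subseteq> copy_sets F G"
  proof
    fix X assume "X \<in> Tr"
    then obtain g where g: "g \<in> PiE ?I P" and X: "X = g ` ?I" by (auto simp: Tr_def)
    have ginj: "inj_on g ?I"
    proof (rule inj_onI)
      fix i j assume ij: "i \<in> ?I" "j \<in> ?I" "g i = g j"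
      have "g i \<in> P i" "g j \<in> P j" using PiE_mem[OF g ij(1)] PiE_mem[OF g ij(2)] .
      then show "i = j" using same ij by simp
    qed
    define h where "h = inv_into ?I g"
    have hg: "h (g i) = i" if "i \<in> ?I" for i using that ginj by (simp add: h_def)
    have h: "bij_betw h X ?I" unfolding h_def X using ginj by (simp add: bij_betw_inv_into bij_betw_imageI)
    have "cg_iso (induced F ?I) F" by (auto simp: cg_iso_def induced_def intro!: exI[of _ id])
    then have "cg_iso (induced G X) F"
    proof (rule cg_iso_pullback[OF _ h])
      fix e assume "e \<in> [X]\<^bsup>2\<^esup>"
      then obtain i j where e: "e = {g i, g j}" "i \<in> ?I" "j \<in> ?I" "i \<noteq> j"
        unfolding nsets_2_eq X by auto
      then have "color G e = color F {i, j}" using col[of i j "g i" "g j"] g by auto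
      then show "color G e = color F (h ` e)" using e hg by simp
    qed
    moreover have "X \<subseteq> verts G" using g P by (auto simp: X)
    moreover have "finite X" "card X = card ?I" using finI ginj by (auto simp: X card_image)
    ultimately show "X \<in> copy_sets F G" by (simp add: copy_sets_def nsets_def)
  qed
  have In: "In i \<subseteq> copy_sets F G" if "i \<in> ?I" for i
    using that P by (auto simp: In_def copy_sets_def induced_def nsets_def)
  have In_sub: "S \<subseteq> P i" "S \<noteq> {}" if "S \<in> In i" for S i
    using that k copy_setsD[of S F "induced G (P i)"] by (auto simp: In_def induced_def)
  have finIn: "finite (In i)" if "i \<in> ?I" for i
    using finP[OF that] by (simp add: In_def induced_def finite_copy_sets)
  have "Tr \<inter> (\<Union>i\<in>?I. In i) = {}"
  proof (rule ccontr)
    assume "Tr \<inter> (\<Union>i\<in>?I. In i) \<noteq> {}"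
    then obtain g i where g: "g \<in> PiE ?I P" and i: "i \<in> ?I" "g ` ?I \<in> In i" by (auto simp: Tr_def)
    have "\<not> ?I \<subseteq> {i}" using k card_mono[of "{i}" ?I] by auto
    then obtain j where j: "j \<in> ?I" "j \<noteq> i" by auto
    have "g j \<in> P i" "g j \<in> P j" using In_sub(1)[OF i(2)] g j by auto
    then show False using same j i by blast
  qed
  moreover have "card (\<Union>i\<in>?I. In i) = (\<Sum>i\<in>?I. card (In i))"
  proof (rule card_UN_disjoint)
    show "\<forall>i\<in>?I. \<forall>j\<in>?I. i \<noteq> j \<longrightarrow> In i \<inter> In j = {}"
    proof (intro ballI impI equals0I)
      fix i j S assume "i \<in> ?I" "j \<in> ?I" "i \<noteq> j" "S \<in> In i \<inter> In j"
      then show False using In_sub[of S i] In_sub[of S j] same by blast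
    qed
  qed (use finI finIn in auto)
  ultimately have "card (Tr \<union> (\<Union>i\<in>?I. In i)) = (\<Prod>i\<in>?I. card (P i)) + (\<Sum>i\<in>?I. card (In i))"
    using finI finIn finTr by (subst card_Un_disjoint) (auto simp: cardTr)
  moreover have "card (Tr \<union> (\<Union>i\<in>?I. In i)) \<le> card (copy_sets F G)"
    using Tr In fin by (intro card_mono finite_copy_sets) auto
  ultimately show ?thesis by (simp add: copies_eq_card In_def)
qed

section \<open>Number of copies in an iterated balanced blow-up\<close>

lemma partition_with_sizes:
  assumes "finite I" "finite X" "(\<Sum>i\<in>I. s i) = card X"
  shows "\<exists>P. X = (\<Union>i\<in>I. P i) \<and> disjoint_family_on P I \<and> (\<forall>i\<in>I. card (P i) = s i)"
  using assms
proof (induction arbitrary: X rule: finite_induct)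
  case empty
  then show ?case by (auto simp: disjoint_family_on_def)
next
  case (insert a I)
  then have "s a \<le> card X" by simp
  then obtain Y where Y: "Y \<subseteq> X" "card Y = s a" "finite Y" by (rule obtain_subset_with_card_n)
  have "(\<Sum>i\<in>I. s i) = card (X - Y)" using insert Y by (simp add: card_Diff_subset)
  then obtain P where P: "X - Y = (\<Union>i\<in>I. P i)" "disjoint_family_on P I" "\<forall>i\<in>I. card (P i) = s i"
    using insert.IH[of "X - Y"] insert.prems by auto
  define Q where "Q = P(a := Y)"
  have QI: "Q i = P i" if "i \<in> I" for i using that insert.hyps by (auto simp: Q_def)
  have "(\<Union>i\<in>insert a I. Q i) = Q a \<union> (\<Union>i\<in>I. P i)" using QI by auto
  also have "\<dots> = Y \<union> (X - Y)" by (simp add: P(1) Q_def)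
  finally have "(\<Union>i\<in>insert a I. Q i) = Y \<union> (X - Y)" .
  moreover have "disjoint_family_on Q (insert a I)"
    unfolding disjoint_family_on_def
  proof (intro ballI impI)
    fix i j assume ij: "i \<in> insert a I" "j \<in> insert a I" "i \<noteq> j"
    have YP: "Y \<inter> P i = {}" if "i \<in> I" for i using that P(1) by blast
    show "Q i \<inter> Q j = {}"
    proof (cases "i = a \<or> j = a")
      case True
      then show ?thesis using ij YP[of i] YP[of j] by (auto simp: Q_def)
    next
      case False
      then show ?thesis using ij QI P(2) by (simp add: disjoint_family_on_def)
    qed
  qed
  moreover have "\<forall>i\<in>insert a I. card (Q i) = s i" using QI P(3) Y by (auto simp: Q_def)
  ultimately show ?case using Y by (intro exI[of _ Q]) auto
qed

lemma balanced_sizes: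
  assumes "finite I" "card I = k" "0 < k"
  obtains s :: "'i \<Rightarrow> nat" where "(\<Sum>i\<in>I. s i) = n" "\<And>i. n div k \<le> s i \<and> s i \<le> n div k + 1"
proof -
  have "n mod k \<le> card I" using assms by (simp add: less_imp_le)
  then obtain J where J: "J \<subseteq> I" "card J = n mod k" "finite J" by (rule obtain_subset_with_card_n)
  define s where "s = (\<lambda>i. n div k + (if i \<in> J then 1 else 0))"
  have "(\<Sum>i\<in>I. s i) = k * (n div k) + card (I \<inter> J)"
    using assms by (simp add: s_def sum.distrib flip: sum.inter_restrict)
  also have "I \<inter> J = J" using J by auto
  finally have "(\<Sum>i\<in>I. s i) = n" using J by simp
  then show thesis using that[of s] by (simp add: s_def)
qed

text \<open>For equal parts of size \<open>n / k\<close>, the leading coefficient \<open>b\<close>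
  solves the recursion exactly. Rounding costs a term of order \<open>n ^ (k - 1)\<close>; the
  correction with \<open>K\<close> covers it, since the corrections of the parts together are
  smaller than that of the whole.\<close>

lemma blowup_recursion:
  fixes s :: "'i \<Rightarrow> real" and n :: real and k :: nat
  defines "b \<equiv> 1 / (real k ^ k - real k)"
  defines "K \<equiv> 2 * b * real k ^ 2"
  assumes I: "finite I" "card I = k" and k: "4 \<le> k" and n: "real k ^ 2 \<le> n"
    and s: "(\<Sum>i\<in>I. s i) = n" "\<And>i. i \<in> I \<Longrightarrow> n / real k - 1 \<le> s i" "\<And>i. i \<in> I \<Longrightarrow> s i \<le> n / real k + 1"
  shows "b * n ^ k - K * n ^ (k - 1) \<le> (\<Prod>i\<in>I. s i) + (\<Sum>i\<in>I. b * s i ^ k - K * s i ^ (k - 1))"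
proof -
  define m where "m = n / real k"
  define Q where "Q = real k ^ k"
  have nm: "n = real k * m" using k by (simp add: m_def)
  have mk: "real k \<le> m" using n k by (simp add: m_def field_simps power2_eq_square)
  have m1: "4 \<le> m" using mk k by linarith
  have Q: "16 * real k ^ 2 \<le> Q"
  proof -
    have "(16::real) \<le> real k ^ 2" using k power_mono[of 4 "real k" 2] by simp
    then have "16 * real k ^ 2 \<le> real k ^ 2 * real k ^ 2" by (rule mult_right_mono) simp
    also have "\<dots> = real k ^ 4" by (simp flip: power_add)
    also have "\<dots> \<le> Q" unfolding Q_def using k by (intro power_increasing) auto
    finally show ?thesis .
  qed
  have kk: "real k \<le> real k ^ 2" using k by (intro self_le_power) auto
  have Qk: "6 * real k ^ 2 \<le> Q - real k" "0 < Q - real k" using Q kk k by (simp_all, linarith+)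
  have b: "b = 1 / (Q - real k)" "0 < b" using Qk by (auto simp: b_def Q_def)
  have K0: "0 \<le> K" using b by (simp add: K_def)
  have pow: "z ^ k = z * z ^ (k - 1)" for z :: real using k by (simp flip: power_Suc)
  have s0: "0 \<le> s i" if "i \<in> I" for i using s(2)[OF that] m1 by (simp add: m_def)
  have "m ^ k - real k * m ^ (k - 1) = m ^ k * (1 + real k * (- 1 / m))"
    using m1 pow[of m] by (simp add: field_simps)
  also have "\<dots> \<le> m ^ k * (1 + - 1 / m) ^ k"
    using m1 by (intro mult_left_mono Bernoulli_inequality) (auto simp: field_simps)
  also have "\<dots> = (m - 1) ^ k" using m1 by (simp add: field_simps flip: power_mult_distrib)
  also have "\<dots> = (\<Prod>i\<in>I. m - 1)" using I by simp
  also have "\<dots> \<le> (\<Prod>i\<in>I. s i)" using s(2) m1 by (intro prod_mono) (auto simp: m_def)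
  finally have 1: "m ^ k - real k * m ^ (k - 1) \<le> (\<Prod>i\<in>I. s i)" .
  \<comment> \<open>The tangent line of the power at \<open>m\<close>; its linear terms cancel in
    the sum because the sizes add up to \<open>k * m\<close>.\<close>
  have "m ^ k + real k * m ^ (k - 1) * (s i - m) \<le> s i ^ k" if i: "i \<in> I" for i
  proof -
    have "m ^ k + real k * m ^ (k - 1) * (s i - m) = m ^ k * (1 + real k * (s i / m - 1))"
      using m1 pow[of m] by (simp add: field_simps)
    also have "\<dots> \<le> m ^ k * (1 + (s i / m - 1)) ^ k"
      using m1 s0[OF i] by (intro mult_left_mono Bernoulli_inequality) auto
    also have "\<dots> = s i ^ k" using m1 by (simp flip: power_mult_distrib)
    finally show ?thesis .
  qed
  then have "(\<Sum>i\<in>I. m ^ k + real k * m ^ (k - 1) * (s i - m)) \<le> (\<Sum>i\<in>I. s i ^ k)" by (rule sum_mono)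
  also have "(\<Sum>i\<in>I. m ^ k + real k * m ^ (k - 1) * (s i - m)) = real k * m ^ k"
    using I s(1) by (simp add: sum.distrib sum_subtractf nm flip: sum_distrib_left)
  finally have 2: "b * (real k * m ^ k) \<le> b * (\<Sum>i\<in>I. s i ^ k)" using b(2) by (intro mult_left_mono) auto
  \<comment> \<open>Since \<open>n\<close> is at least \<open>k ^ 2\<close>, the average size
    \<open>m\<close> is at least \<open>k\<close>, so the excess of \<open>1\<close> costs a factor
    of at most \<open>exp 1 <= 3\<close>.\<close>
  have "s i ^ (k - 1) \<le> 3 * m ^ (k - 1)" if i: "i \<in> I" for i
  proof -
    have "s i ^ (k - 1) \<le> (m + 1) ^ (k - 1)" using s(3)[OF i] s0[OF i] by (intro power_mono) (auto simp: m_def)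
    also have "\<dots> = m ^ (k - 1) * (1 + 1 / m) ^ (k - 1)"
      using m1 by (simp add: field_simps flip: power_mult_distrib)
    also have "(1 + 1 / m) ^ (k - 1) \<le> (1 + 1 / real k) ^ (k - 1)"
      using m1 mk k by (intro power_mono) (auto simp: field_simps)
    also have "(1 + 1 / real k) ^ (k - 1) \<le> (1 + 1 / real k) ^ k" by (intro power_increasing) auto
    also have "(1 + 1 / real k) ^ k \<le> exp 1" using k by (intro exp_ge_one_plus_x_over_n_power_n) auto
    also have "exp 1 \<le> (3::real)" by (rule exp_le)
    finally show ?thesis using m1 by (simp add: mult.commute)
  qed
  then have "(\<Sum>i\<in>I. s i ^ (k - 1)) \<le> real k * (3 * m ^ (k - 1))"
    using sum_bounded_above[of I "\<lambda>i. s i ^ (k - 1)" "3 * m ^ (k - 1)"] I by simp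
  then have 3: "K * (\<Sum>i\<in>I. s i ^ (k - 1)) \<le> K * (real k * (3 * m ^ (k - 1)))"
    using K0 by (rule mult_left_mono)
  have "b * n ^ k = b * Q * m ^ k" by (simp add: nm power_mult_distrib Q_def)
  also have "b * Q = 1 + b * real k" using Qk by (simp add: b field_simps)
  finally have 4: "b * n ^ k = m ^ k + b * (real k * m ^ k)" by (simp add: algebra_simps)
  \<comment> \<open>The loss \<open>(k + 3 * K * k) * m ^ (k - 1)\<close> is at most
    \<open>2 * k * m ^ (k - 1)\<close>, and \<open>K\<close> is chosen so that
    \<open>K * k ^ (k - 1) = 2 * k * b * Q\<close>, which is at least \<open>2 * k\<close>.\<close>
  have "3 * K \<le> 1" using Qk by (simp add: K_def b field_simps)
  then have "3 * K * real k \<le> 1 * real k" by (rule mult_right_mono) simp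
  then have "real k + 3 * K * real k \<le> 2 * real k" by linarith
  also have "\<dots> \<le> 2 * real k * (b * Q)"
  proof -
    have "1 \<le> b * Q" using Qk(2) by (simp add: b field_simps)
    then show ?thesis using mult_left_mono[of 1 "b * Q" "2 * real k"] by simp
  qed
  also have "\<dots> = K * real k ^ (k - 1)"
    using pow[of "real k"] by (simp add: K_def Q_def power2_eq_square)
  finally have "(real k + 3 * K * real k) * m ^ (k - 1) \<le> K * real k ^ (k - 1) * m ^ (k - 1)"
    using m1 by (intro mult_right_mono) auto
  then have 5: "real k * m ^ (k - 1) + K * (real k * (3 * m ^ (k - 1))) \<le> K * n ^ (k - 1)"
    by (simp add: nm power_mult_distrib algebra_simps)
  show ?thesis using 1 2 3 4 5 by (simp add: sum_subtractf flip: sum_distrib_left)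
qed

text \<open>Strong induction on the number of vertices. Prescribing the vertex set \<open>X\<close>
  lets the graphs on the parts be glued without renaming.\<close>

lemma iterated_blowup_exists:
  fixes F :: "('v, 'c) cgraph" and X :: "nat set"
  defines "k \<equiv> card (verts F)"
  defines "b \<equiv> 1 / (real k ^ k - real k)"
  defines "K \<equiv> 2 * b * real k ^ 2"
  assumes T: "T \<noteq> {}" and k: "4 \<le> k" and X: "finite X"
  shows "\<exists>\<chi>. iterated_blowup T F \<lparr>verts = X, color = \<chi>\<rparr> \<and>
    b * real (card X) ^ k - K * real (card X) ^ (k - 1) \<le> real (copies F \<lparr>verts = X, color = \<chi>\<rparr>)"
  using X
proof (induction "card X" arbitrary: X rule: less_induct)
  case less
  define n where "n = card X"
  have b0: "0 \<le> b"
  proof -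
    have "real k ^ 1 \<le> real k ^ k" using k by (intro power_increasing) auto
    then show ?thesis by (simp add: b_def)
  qed
  \<comment> \<open>For \<open>n\<close> up to \<open>2 * k ^ 2\<close> the value of
    \<open>K\<close> makes the bound nonpositive, so any iterated blow-up will do; this covers the
    base case \<open>n < k\<close>.\<close>
  have trivial: "b * real n ^ k - K * real n ^ (k - 1) \<le> 0" if "real n \<le> 2 * real k ^ 2"
  proof -
    have "b * real n ^ k = b * real n * real n ^ (k - 1)" using k by (simp flip: power_Suc)
    also have "\<dots> \<le> K * real n ^ (k - 1)"
      unfolding K_def using that b0 by (intro mult_right_mono) (auto simp: mult.assoc mult.left_commute intro: mult_left_mono)
    finally show ?thesis by simp
  qed
  show ?case
  proof (cases "n < k")
    case True
    obtain t where "t \<in> T" using T by auto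
    then have "iterated_blowup T F \<lparr>verts = X, color = \<lambda>_. t\<rparr>"
      using True less.prems by (intro iterated_blowup.small) (auto simp: colored_complete_def n_def k_def)
    moreover have "real k * 1 \<le> real k * real k" using k by (intro mult_left_mono) auto
    then have "real n \<le> 2 * real k ^ 2" unfolding power2_eq_square using True by linarith
    ultimately show ?thesis using trivial by (auto simp: n_def intro: order_trans)
  next
    case False
    have finI: "finite (verts F)" using k card.infinite unfolding k_def by fastforce
    obtain s where s: "(\<Sum>i\<in>verts F. s i) = n" "\<And>i. n div k \<le> s i \<and> s i \<le> n div k + 1"
      using balanced_sizes[of "verts F" k n] finI k by (auto simp: k_def)
    obtain P where P: "X = (\<Union>i\<in>verts F. P i)" "disjoint_family_on P (verts F)"
      "\<And>i. i \<in> verts F \<Longrightarrow> card (P i) = s i"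
      using partition_with_sizes[OF finI less.prems, of s] s(1) by (auto simp: n_def)
    have finP: "finite (P i)" if "i \<in> verts F" for i using that P(1) less.prems by (auto intro: finite_subset)
    have q1: "1 \<le> n div k" using False k by (simp add: Suc_le_eq div_greater_zero_iff)
    have smaller: "s i < n" for i
    proof -
      have "4 * (n div k) \<le> k * (n div k)" using k by (rule mult_le_mono1)
      also have "\<dots> \<le> n" by simp
      finally show ?thesis using s(2)[of i] q1 by linarith
    qed
    have "\<forall>i\<in>verts F. \<exists>\<chi>. iterated_blowup T F \<lparr>verts = P i, color = \<chi>\<rparr> \<and>
      b * real (s i) ^ k - K * real (s i) ^ (k - 1) \<le> real (copies F \<lparr>verts = P i, color = \<chi>\<rparr>)"
    proof
      fix i assume i: "i \<in> verts F"
      show "\<exists>\<chi>. iterated_blowup T F \<lparr>verts = P i, color = \<chi>\<rparr> \<and>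
        b * real (s i) ^ k - K * real (s i) ^ (k - 1) \<le> real (copies F \<lparr>verts = P i, color = \<chi>\<rparr>)"
        using less.hyps[of "P i"] smaller[of i] P(3)[OF i] finP[OF i] by (simp add: n_def)
    qed
    from bchoice[OF this] obtain \<chi> where \<chi>: "\<And>i. i \<in> verts F \<Longrightarrow> iterated_blowup T F \<lparr>verts = P i, color = \<chi> i\<rparr>"
      and \<chi>_copies: "\<And>i. i \<in> verts F \<Longrightarrow> b * real (s i) ^ k - K * real (s i) ^ (k - 1)
        \<le> real (copies F \<lparr>verts = P i, color = \<chi> i\<rparr>)" by auto
    define lab where "lab = (\<lambda>x. SOME i. i \<in> verts F \<and> x \<in> P i)"
    have lab: "lab x = i" if "i \<in> verts F" "x \<in> P i" for i x
      unfolding lab_def using that P(2) by (intro some_equality) (auto simp: disjoint_family_on_def)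
    \<comment> \<open>A pair with a single label lies inside a part and keeps the color given there;
      other pairs take their color from \<open>F\<close>.\<close>
    define G where "G = \<lparr>verts = X,
      color = (\<lambda>e. if card (lab ` e) = 1 then \<chi> (the_elem (lab ` e)) e else color F (lab ` e))\<rparr>"
    have inner: "color G e = \<chi> i e" if "i \<in> verts F" "e \<in> [P i]\<^bsup>2\<^esup>" for i e
    proof -
      have "e \<noteq> {}" "e \<subseteq> P i" using that(2) by (auto simp: nsets_def)
      then have "lab ` e = {i}" using lab[OF that(1)] by auto
      then show ?thesis by (simp add: G_def)
    qed
    have cross: "color G {v, w} = color F {i, j}"
      if "i \<in> verts F" "j \<in> verts F" "i \<noteq> j" "v \<in> P i" "w \<in> P j" for i j v w
      using that lab[of i v] lab[of j w] by (simp add: G_def)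
    have "iterated_blowup T F G"
    proof (rule iterated_blowup.blowup[where P = P])
      show "\<forall>i\<in>verts F. \<forall>j\<in>verts F. \<bar>int (card (P i)) - int (card (P j))\<bar> \<le> 1"
      proof (intro ballI)
        fix i j assume "i \<in> verts F" "j \<in> verts F"
        then show "\<bar>int (card (P i)) - int (card (P j))\<bar> \<le> 1" 
          using s(2)[of i] s(2)[of j] P(3)[of i] P(3)[of j] by linarith
      qed
      show "\<forall>i\<in>verts F. iterated_blowup T F (induced G (P i))"
      proof
        fix i assume i: "i \<in> verts F"
        show "iterated_blowup T F (induced G (P i))"
          by (rule iterated_blowup_cong[OF \<chi>[OF i]]) (use inner[OF i] in \<open>auto simp: induced_def\<close>)
      qed
    qed (use P less.prems False cross in \<open>auto simp: G_def n_def k_def\<close>)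
    moreover have "b * real n ^ k - K * real n ^ (k - 1) \<le> real (copies F G)"
    proof (cases "real n \<le> 2 * real k ^ 2")
      case True
      then show ?thesis using trivial by (auto intro: order_trans)
    next
      case large: False
      have "copies F \<lparr>verts = P i, color = \<chi> i\<rparr> \<le> copies F (induced G (P i))" if i: "i \<in> verts F" for i
        unfolding copies_eq_card
      proof (intro card_mono subsetI)
        show "finite (copy_sets F (induced G (P i)))" using finP[OF i] by (simp add: finite_copy_sets induced_def)
        fix S assume S: "S \<in> copy_sets F \<lparr>verts = P i, color = \<chi> i\<rparr>"
        then have SP: "S \<in> [P i]\<^bsup>k\<^esup>" "S \<subseteq> P i" by (auto simp: copy_sets_def k_def nsets_def)
        have "cg_iso (induced (induced G (P i)) S) F"
        proof (rule cg_iso_pullback[of "\<lparr>verts = P i, color = \<chi> i\<rparr>" S F id])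
          fix e assume "e \<in> [S]\<^bsup>2\<^esup>"
          then have "e \<in> [P i]\<^bsup>2\<^esup>" using nsets_mono[OF SP(2)] by blast
          then show "color (induced G (P i)) e = color \<lparr>verts = P i, color = \<chi> i\<rparr> (id ` e)"
            using inner[OF i] by (simp add: induced_def)
        qed (use S in \<open>auto simp: copy_sets_def\<close>)
        then show "S \<in> copy_sets F (induced G (P i))" using SP(1) by (simp add: copy_sets_def induced_def k_def)
      qed
      then have "b * real (s i) ^ k - K * real (s i) ^ (k - 1) \<le> real (copies F (induced G (P i)))"
        if "i \<in> verts F" for i using \<chi>_copies[OF that] that by (meson of_nat_le_iff order_trans)
      then have le: "(\<Sum>i\<in>verts F. b * real (s i) ^ k - K * real (s i) ^ (k - 1))
        \<le> (\<Sum>i\<in>verts F. real (copies F (induced G (P i))))" by (rule sum_mono)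
      have big: "real k ^ 2 \<le> real n" using large zero_le_power2[of "real k"] by linarith
      have sum_s: "(\<Sum>i\<in>verts F. real (s i)) = real n" using s(1) by (simp flip: of_nat_sum)
      have "real n / real k - 1 \<le> real (s i)" "real (s i) \<le> real n / real k + 1" for i
      proof -
        have "real n / real k - 1 \<le> real (n div k)" "real (n div k) \<le> real n / real k"
          using floor_divide_of_nat_eq[of n k, where 'a = real] by linarith+
        moreover have "real (n div k) \<le> real (s i)" "real (s i) \<le> real (n div k) + 1"
          using s(2)[of i] by linarith+
        ultimately show "real n / real k - 1 \<le> real (s i)" "real (s i) \<le> real n / real k + 1" by linarith+
      qed
      then have "b * real n ^ k - K * real n ^ (k - 1)
        \<le> (\<Prod>i\<in>verts F. real (s i)) + (\<Sum>i\<in>verts F. b * real (s i) ^ k - K * real (s i) ^ (k - 1))"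
        unfolding b_def K_def using finI k big sum_s by (intro blowup_recursion) (simp_all add: k_def)
      also have "\<dots> \<le> (\<Prod>i\<in>verts F. real (card (P i))) + (\<Sum>i\<in>verts F. real (copies F (induced G (P i))))"
        using le P(3) by simp
      also have "\<dots> = real ((\<Prod>i\<in>verts F. card (P i)) + (\<Sum>i\<in>verts F. copies F (induced G (P i))))" by simp
      also have "\<dots> \<le> real (copies F G)"
        unfolding of_nat_le_iff using k P less.prems cross
        by (intro copies_blowup_ge) (auto simp: k_def G_def)
      finally show ?thesis .
    qed
    ultimately show ?thesis by (auto simp: n_def G_def)
  qed
qed

section \<open>The inducibility\<close>

text \<open>The densities share the denominator \<open>n choose k\<close>, so they form a finite set
  with a maximum. The lower bound comes from \<open>iterated_blowup_exists\<close>, the upper one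
  from blow-ups being admissible colored graphs.\<close>

lemma max_blowup_density_bounds:
  fixes F :: "('v, 'c) cgraph"
  defines "k \<equiv> card (verts F)"
  defines "b \<equiv> 1 / (real k ^ k - real k)"
  defines "K \<equiv> 2 * b * real k ^ 2"
  assumes F: "colored_complete T F" and T: "T \<noteq> {}" and k: "4 \<le> k"
  shows "(b * real n ^ k - K * real n ^ (k - 1)) / real (n choose k) \<le> max_blowup_density T F n"
    and "max_blowup_density T F n \<le> ind T F n"
proof -
  let ?D = "{copy_density F G |G :: (nat, 'c) cgraph. iterated_blowup T F G \<and> card (verts G) = n}"
  have cc: "colored_complete T G" if "iterated_blowup T F G" for G :: "(nat, 'c) cgraph"
    by (rule iterated_blowup_colored_complete[OF F that])
  have "?D \<subseteq> (\<lambda>m. real m / real (n choose k)) ` {..n choose k}"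
  proof
    fix x assume "x \<in> ?D"
    then obtain G :: "(nat, 'c) cgraph" where G: "x = copy_density F G" "iterated_blowup T F G" "card (verts G) = n"
      by blast
    have "copies F G \<le> n choose k"
      using copies_le_choose[of G F] cc[OF G(2)] G(3) by (simp add: colored_complete_def k_def)
    then show "x \<in> (\<lambda>m. real m / real (n choose k)) ` {..n choose k}"
      using G by (auto simp: copy_density_def k_def)
  qed
  then have fin: "finite ?D" by (rule finite_subset) simp
  obtain \<chi> where \<chi>: "iterated_blowup T F \<lparr>verts = {..<n}, color = \<chi>\<rparr>"
    "b * real n ^ k - K * real n ^ (k - 1) \<le> real (copies F \<lparr>verts = {..<n}, color = \<chi>\<rparr>)"
    using iterated_blowup_exists[OF T, of F "{..<n}"] k unfolding k_def b_def K_def by auto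
  then have mem: "copy_density F \<lparr>verts = {..<n}, color = \<chi>\<rparr> \<in> ?D" by force
  have "(b * real n ^ k - K * real n ^ (k - 1)) / real (n choose k)
      \<le> copy_density F \<lparr>verts = {..<n}, color = \<chi>\<rparr>"
    using \<chi>(2) by (simp add: copy_density_def k_def divide_right_mono)
  also have "\<dots> \<le> max_blowup_density T F n"
    unfolding max_blowup_density_def using fin mem by (rule Max_ge)
  finally show "(b * real n ^ k - K * real n ^ (k - 1)) / real (n choose k) \<le> max_blowup_density T F n" .
  have "max_blowup_density T F n \<in> ?D"
    unfolding max_blowup_density_def using fin mem by (intro Max_in) blast+
  then obtain G :: "(nat, 'c) cgraph" where G: "max_blowup_density T F n = copy_density F G"
    "iterated_blowup T F G" "card (verts G) = n" by blast
  have "copies F G \<le> max_copies T F n" using copies_le_max_copies[OF cc[OF G(2)] G(3)] .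
  then show "max_blowup_density T F n \<le> ind T F n"
    using G by (simp add: copy_density_def ind_def divide_right_mono)
qed

text \<open>\<open>max_blowup_density\<close> lies between \<open>low\<close>, which tends to
  \<open>b * fact k\<close>, and \<open>ind\<close>. The limits give \<open>b <= dens\<close>, hence
  also the positivity that \<open>dens_le\<close> presupposes; \<open>dens_le\<close> gives the
  converse, and the sandwich yields the fractalizer property.\<close>

lemma (in dense_rainbow) fractalizer_and_inducibility:
  "fractalizer T R \<and> inducibility T R = fact k / (real k ^ k - real k)"
proof -
  define b where "b = 1 / (real k ^ k - real k)"
  define K where "K = 2 * b * real k ^ 2"
  define low where "low = (\<lambda>n. (b * real n ^ k - K * real n ^ (k - 1)) / real (n choose k))"
  have low: "low n \<le> max_blowup_density T R n" "max_blowup_density T R n \<le> ind T R n" for n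
    using max_blowup_density_bounds[OF colored_complete_R T_nonempty, of n] k_ge_4
    by (simp_all add: low_def b_def K_def card_verts_R)
  have "real k ^ 1 < real k ^ k" using k_ge_4 by (intro power_strict_increasing) auto
  then have pos: "0 < real k ^ k - real k" by simp
  then have b0: "0 < b" by (simp add: b_def)
  have "(\<lambda>n. (b - K / real n) / (real (n choose k) / real n ^ k)) \<longlonglongrightarrow> (b - 0) / (1 / fact k)"
    by (intro tendsto_divide tendsto_choose_over_power tendsto_diff tendsto_const
        tendsto_divide_0[OF tendsto_const] filterlim_at_top_imp_at_infinity filterlim_real_sequentially) simp
  moreover have "\<forall>\<^sub>F n in sequentially. (b - K / real n) / (real (n choose k) / real n ^ k) = low n"
  proof (rule eventually_sequentiallyI[of 1])
    fix n :: nat assume n: "1 \<le> n"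
    have "real n ^ k = real n * real n ^ (k - 1)" using k_pos by (simp flip: power_Suc)
    then have "K / real n * real n ^ k = K * real n ^ (k - 1)" using n by (simp only:) simp
    then have "(b - K / real n) * real n ^ k = b * real n ^ k - K * real n ^ (k - 1)"
      by (simp only: left_diff_distrib)
    then show "(b - K / real n) / (real (n choose k) / real n ^ k) = low n" by (simp add: low_def)
  qed
  ultimately have lim_low: "low \<longlonglongrightarrow> b * fact k" by (simp add: filterlim_cong)
  have lim_ind: "ind T R \<longlonglongrightarrow> inducibility T R"
    using convergent_ind[OF T_nonempty, of R] by (simp add: inducibility_def convergent_LIMSEQ_iff)
  have ge: "b * fact k \<le> inducibility T R"
    using order_trans[OF low] by (intro LIMSEQ_le[OF lim_low lim_ind]) blast
  then have "b \<le> dens" by (simp add: dens_def le_divide_eq)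
  then have "dens * (real k ^ k - real k) \<le> 1" using b0 by (intro dens_le) linarith
  then have "dens \<le> b" using pos by (simp add: b_def pos_le_divide_eq)
  then have "dens = b" using \<open>b \<le> dens\<close> by simp
  then have eq: "inducibility T R = b * fact k" by (simp add: dens_def divide_eq_eq)
  have "max_blowup_density T R \<longlonglongrightarrow> inducibility T R"
  proof (rule tendsto_sandwich[OF _ _ _ lim_ind])
    show "low \<longlonglongrightarrow> inducibility T R" using lim_low by (simp only: eq)
  qed (simp_all only: low eventually_True)
  then show ?thesis by (simp add: fractalizer_def eq b_def)
qed

theorem theorem1p3:
  shows "\<exists>C::real. C > 0 \<and>
    (\<forall>(k::nat) (E :: nat set set).
      k \<ge> 2 \<longrightarrow> simple_graph {1..k} E \<longrightarrow> graph_connected {1..k} E \<longrightarrow>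
      real (min_degree {1..k} E) \<ge> C * ln (real k) \<longrightarrow>
      fractalizer (rainbow_colors E) (rainbow k E) \<and>
      inducibility (rainbow_colors E) (rainbow k E) = fact k / (real k ^ k - real k))"
proof (intro exI[of _ 21] conjI allI impI)
  fix k :: nat and E :: "nat set set"
  assume k: "2 \<le> k" and simple: "simple_graph {1..k} E" and conn: "graph_connected {1..k} E"
    and deg: "21 * ln (real k) \<le> real (min_degree {1..k} E)"
  define d where "d = min_degree {1..k} E"
  \<comment> \<open>The constant \<open>21\<close> is \<open>14 + 7\<close>: for
    \<open>k >= 2\<close> the factor \<open>k ^ 14\<close> is at least
    \<open>2 ^ 14 = 16384\<close>, and \<open>exp 1 <= 3\<close> turns \<open>exp d\<close> into
    \<open>3 ^ d\<close>.\<close>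
  have "12000 * real k ^ 7 \<le> real k ^ 14 * real k ^ 7"
  proof (rule mult_right_mono)
    have "(12000::real) \<le> 2 ^ 14" by simp
    also have "\<dots> \<le> real k ^ 14" using k by (intro power_mono) auto
    finally show "12000 \<le> real k ^ 14" .
  qed simp
  also have "\<dots> = exp (21 * ln (real k))"
    using k exp_of_nat_mult[of 21 "ln (real k)"] power_add[of "real k" 14 7] by simp
  also have "\<dots> \<le> exp (real d)" using deg by (simp add: d_def)
  also have "\<dots> = exp 1 ^ d" using exp_of_nat_mult[of d "1::real"] by simp
  also have "\<dots> \<le> 3 ^ d" by (intro power_mono exp_le) simp
  finally have "12000 * real k ^ 7 \<le> 3 ^ d" .
  moreover have "d \<le> vertex_degree E i" if "i \<in> {1..k}" for i
    unfolding d_def min_degree_def using that by (intro Min_le) auto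
  ultimately have "dense_rainbow k E d"
    using k simple conn by unfold_locales (auto simp: simple_graph_def)
  then show "fractalizer (rainbow_colors E) (rainbow k E)"
    "inducibility (rainbow_colors E) (rainbow k E) = fact k / (real k ^ k - real k)"
    using dense_rainbow.fractalizer_and_inducibility by blast+
qed simp

end
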